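(* Let $\mathcal{G}_P$ be the parallelogram framework of a regular multigrid parallelogram tiling $P$ of $\mathbb{R}^2$, and suppose that $\mathcal{G}_P$ is periodic for a basis $\underline{a}$ (so that it is a crystallographic framework with periodicity basis $\underline{a}$). Then the unreduced zero mode spectrum ${\bf K}(\mathcal{G}_P,\underline{a})$ is equal to the union of ${\bf L}_{\rm slip}(\mathcal{G}_P,\underline{a})$ and its integral translates (its translates by vectors of $\mathbb{Z}^2$). In particular \[ \Omega^{\rm log}(\mathcal{G}_P,\underline{a})=\Omega^{\rm log}_{\rm slip}(\mathcal{G}_P,\underline{a}). \]
   Context: Frameworks. A bar-joint framework $\mathcal{G}=(G,p)$ in $\mathbb{R}^2$ is a countable simple graph $G=(V,E)$ with a placement $p:V\to\mathbb{R}^2$ by distinct points (joints). It is a Delone framework if its set of joints is a Delone set (uniformly discrete and relatively dense) and the bar lengths $|p(v)-p(w)|$, $vw\in E$, are uniformly bounded. A velocity field is a map $u:p(V)\to\mathbb{C}^2$; it is an infinitesimal flex if $\langle u(p(v))-u(p(w)),p(v)-p(w)\rangle=0$ for all $vw\in E$. A framework is crystallographic with periodicity basis $\underline{a}=\{a_1,a_2\}$ if it is invariant (joints and bars) under translation by $a_1$ and $a_2$, with finitely many orbits of joints and bars under the generated translation group. A line figure is a set of lines through the origin (identified with its union). Zero mode spectrum. For a crystallographic framework $\mathcal{C}$ with periodicity basis $\underline{a}$, ${\bf K}(\mathcal{C},\underline{a})$ is the set of $(\gamma_1,\gamma_2)\in\mathbb{R}^2$ for which there is a nonzero infinitesimal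 flex $u$ with $u(p_j+k_1a_1+k_2a_2)=e^{2\pi i(k_1\gamma_1+k_2\gamma_2)}u(p_j)$ for all joints $p_j$ and all $k\in\mathbb{Z}^2$. $\Omega^{\rm log}(\mathcal{C},\underline{a})\subset[0,1)^2$ is its image under reduction modulo $\mathbb{Z}^2$. Phase fields. For a basis $\underline{\bf t}=\{{\bf t_1},{\bf t_2}\}$ of $\mathbb{R}^2$ and $\lambda\in\mathbb{T}$ (the unit circle), the banded phase field $\phi_{(1,\lambda),\underline{\bf t}}:\mathbb{R}^2\to\mathbb{T}$ takes the value $\lambda^k$ on the band $\{s_1{\bf t_1}+s_2{\bf t_2}:s_1\in\mathbb{R},\,k\le s_2<k+1\}$, $k\in\mathbb{Z}$. For a scalar function $\phi$ on $\mathbb{R}^2$ and a velocity field $u$, the modulation $\phi\cdot u$ is the pointwise product. $\tau_b$ denotes the constant velocity field with value $b$. Closeness. Velocity fields $u,z$ on the set $J$ of joints are mostly $\epsilon$-close if there is $N_0$ such that for all $N\ge N_0$ and every translate $S$ of the square $[-N,N]^2$, $|\{p\in J\cap S:\|u(p)-z(p)\|_2>\epsilon\}|<\epsilon|J\cap S|$. Slippage. A line $H=\mathbb{R}{\bf t_1}$ is a periodic slippage line for a Delone framework $\mathcal{G}$ if there are a nonzero $b\in\mathbb{R}^2$ and a vector ${\bf t_2}$, with $\{{\bf t_1},{\bf t_2}\}$ a basis, such that for every $\epsilon>0$ there are an infinitesimal flex $u$ of $\mathcal{G}$ and a positive integer $M$ with: (i) $\phi_{(1,\lambda),\{{\bf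 t_1},M{\bf t_2}\}}\cdot u$ is an infinitesimal flex for all $\lambda\in\mathbb{T}$; (ii) $\phi_{(1,\lambda),\{{\bf t_1},M{\bf t_2}\}}\cdot u$ is mostly $\epsilon$-close to the restriction to the joints of $\phi_{(1,\lambda),\{{\bf t_1},M{\bf t_2}\}}\cdot\tau_b$ for all $\lambda\in\mathbb{T}$. The periodic slippage figure $PSF(\mathcal{G})$ is the union of the periodic slippage lines. Reciprocal figures and slippage spectra. For a basis $\underline{a}=\{a_1,a_2\}$ of $\mathbb{R}^2$ and a line $H=\mathbb{R}(\alpha a_1+\beta a_2)$, the reciprocal line is $H^{\underline{a}}=\mathbb{R}(\beta,-\alpha)$ in the reciprocal space $\mathbb{R}^2_{\bf k}$ (a copy of $\mathbb{R}^2$ with standard basis, which also contains ${\bf K}(\mathcal{C},\underline{a})$). For a line figure $F$, $F^{\underline{a}}$ is the union of the lines $H^{\underline{a}}$, $H$ a line of $F$. The slippage spectrum is ${\bf L}_{\rm slip}(\mathcal{G},\underline{a})=PSF(\mathcal{G})^{\underline{a}}$, and $\Omega^{\rm log}_{\rm slip}(\mathcal{G},\underline{a})={\bf L}_{\rm slip}(\mathcal{G},\underline{a})/\mathbb{Z}^2\subset[0,1)^2$ is its reduction modulo $\mathbb{Z}^2$. Multigrid tilings (de Bruijn, Beenker). A multigrid is a union of $r\ge2$ component grids, the $j$th consisting of the parallel lines $\{x:\langle x,n_j\rangle+\gamma_j=ks_j\}$, $k\in\mathbb{Z}$, with unit normals $n_j$ pairwise non-parallel, spacings $s_j>0$ and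 shifts $\gamma_j\in\mathbb{R}$. It is regular if no point lies on more than two of the lines. The associated parallelogram tiling $P$ is the dual tiling: fix edge vectors $d_j=\ell_jn_j$, $\ell_j>0$; each connected component of the complement of the multigrid gives a vertex $\sum_jK_j(x)d_j$, where $x$ is any point of the component and $K_j(x)=\lceil(\langle x,n_j\rangle+\gamma_j)/s_j\rceil$; components sharing a boundary segment on a line of the $j$th grid give vertices joined by an edge (a translate of $d_j$); and each intersection point of two grid lines gives a parallelogram tile. $\mathcal{G}_P$ is the bar-joint framework (a Delone framework) whose joints are the vertices of $P$ and whose bars are the edges of $P$. *)

theory Defs
  imports "HOL-Analysis.Analysis"
begin

section \<open>Frameworks and infinitesimal flexes\<close>

record 'v framework =
  verts :: "'v set"
  edges :: "'v set set"
  place :: "'v \<Rightarrow> real^2"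

definition bar_joint_framework :: "'v framework \<Rightarrow> bool" where
  "bar_joint_framework G \<longleftrightarrow>
     countable (verts G) \<and> (\<forall>e\<in>edges G. e \<subseteq> verts G \<and> card e = 2) \<and> inj_on (place G) (verts G)"

definition joints :: "'v framework \<Rightarrow> (real^2) set" where
  "joints G = place G ` verts G"

definition bars :: "'v framework \<Rightarrow> (real^2) set set" where
  "bars G = (\<lambda>e. place G ` e) ` edges G"

text \<open>Velocity fields are total functions on the plane of which only the values at the joints
  matter. Pairing a complex vector with a real one involves no conjugation.\<close>

type_synonym velocity_field = "real^2 \<Rightarrow> complex^2"

definition pairing :: "complex^2 \<Rightarrow> real^2 \<Rightarrow> complex" where
  "pairing z x = (\<Sum>i\<in>UNIV. z $ i * complex_of_real (x $ i))"

definition infinitesimal_flex :: "'v framework \<Rightarrow> velocity_field \<Rightarrow> bool" where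
  "infinitesimal_flex G u \<longleftrightarrow>
     (\<forall>v w. {v, w} \<in> edges G \<longrightarrow>
        pairing (u (place G v) - u (place G w)) (place G v - place G w) = 0)"

definition is_basis :: "real^2 \<Rightarrow> real^2 \<Rightarrow> bool" where
  "is_basis a b \<longleftrightarrow> independent {a, b} \<and> span {a, b} = UNIV"

definition lattice_vector :: "real^2 \<Rightarrow> real^2 \<Rightarrow> int \<Rightarrow> int \<Rightarrow> real^2" where
  "lattice_vector a\<^sub>1 a\<^sub>2 k\<^sub>1 k\<^sub>2 = of_int k\<^sub>1 *\<^sub>R a\<^sub>1 + of_int k\<^sub>2 *\<^sub>R a\<^sub>2"

definition periodic_framework :: "'v framework \<Rightarrow> real^2 \<Rightarrow> real^2 \<Rightarrow> bool" where
  "periodic_framework G a\<^sub>1 a\<^sub>2 \<longleftrightarrow>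
     is_basis a\<^sub>1 a\<^sub>2 \<and>
     (\<forall>a\<in>{a\<^sub>1, a\<^sub>2}. (+) a ` joints G = joints G \<and> (`) ((+) a) ` bars G = bars G)"

definition crystallographic :: "'v framework \<Rightarrow> real^2 \<Rightarrow> real^2 \<Rightarrow> bool" where
  "crystallographic G a\<^sub>1 a\<^sub>2 \<longleftrightarrow>
     bar_joint_framework G \<and> periodic_framework G a\<^sub>1 a\<^sub>2 \<and>
     finite ((\<lambda>x. {lattice_vector a\<^sub>1 a\<^sub>2 k\<^sub>1 k\<^sub>2 + x | k\<^sub>1 k\<^sub>2. True}) ` joints G) \<and>
     finite ((\<lambda>e. {(+) (lattice_vector a\<^sub>1 a\<^sub>2 k\<^sub>1 k\<^sub>2) ` e | k\<^sub>1 k\<^sub>2. True}) ` bars G)"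


section \<open>Zero mode spectrum\<close>

definition zero_mode_spectrum :: "'v framework \<Rightarrow> real^2 \<Rightarrow> real^2 \<Rightarrow> (real^2) set" where
  "zero_mode_spectrum G a\<^sub>1 a\<^sub>2 =
     {\<gamma>. \<exists>u. infinitesimal_flex G u \<and> (\<exists>x\<in>joints G. u x \<noteq> 0) \<and>
          (\<forall>x\<in>joints G. \<forall>k\<^sub>1 k\<^sub>2 :: int.
             u (x + lattice_vector a\<^sub>1 a\<^sub>2 k\<^sub>1 k\<^sub>2) =
               exp (\<i> * complex_of_real (2 * pi * (of_int k\<^sub>1 * \<gamma> $ 1 + of_int k\<^sub>2 * \<gamma> $ 2))) *s u x)}"

definition integer_vectors :: "(real^2) set" where
  "integer_vectors = {z. \<forall>i. z $ i \<in> \<int>}"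

definition reduce_mod1 :: "real^2 \<Rightarrow> real^2" where
  "reduce_mod1 x = (\<chi> i. frac (x $ i))"

definition zero_mode_spectrum_log :: "'v framework \<Rightarrow> real^2 \<Rightarrow> real^2 \<Rightarrow> (real^2) set" where
  "zero_mode_spectrum_log G a\<^sub>1 a\<^sub>2 = reduce_mod1 ` zero_mode_spectrum G a\<^sub>1 a\<^sub>2"


section \<open>Periodic slippage\<close>

definition phase_field :: "complex \<Rightarrow> real^2 \<Rightarrow> real^2 \<Rightarrow> real^2 \<Rightarrow> complex" where
  "phase_field \<omega> t\<^sub>1 t\<^sub>2 x =
     \<omega> powi (THE k. \<exists>s\<^sub>1 s\<^sub>2. x = s\<^sub>1 *\<^sub>R t\<^sub>1 + s\<^sub>2 *\<^sub>R t\<^sub>2 \<and> of_int k \<le> s\<^sub>2 \<and> s\<^sub>2 < of_int k + 1)"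

definition modulation :: "(real^2 \<Rightarrow> complex) \<Rightarrow> velocity_field \<Rightarrow> velocity_field" where
  "modulation \<phi> u = (\<lambda>x. \<phi> x *s u x)"

definition constant_field :: "real^2 \<Rightarrow> velocity_field" where
  "constant_field b = (\<lambda>x. \<chi> i. complex_of_real (b $ i))"

definition mostly_close :: "(real^2) set \<Rightarrow> real \<Rightarrow> velocity_field \<Rightarrow> velocity_field \<Rightarrow> bool" where
  "mostly_close J \<epsilon> u z \<longleftrightarrow>
     (\<exists>N\<^sub>0::real. \<forall>N\<ge>N\<^sub>0. \<forall>c. \<forall>S. S = (+) c ` cbox (vec (- N)) (vec N) \<longrightarrow>
        real (card {p \<in> J \<inter> S. norm (u p - z p) > \<epsilon>}) < \<epsilon> * real (card (J \<inter> S)))"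

definition periodic_slippage_line :: "'v framework \<Rightarrow> (real^2) set \<Rightarrow> bool" where
  "periodic_slippage_line G H \<longleftrightarrow>
     (\<exists>t\<^sub>1 t\<^sub>2 b. H = span {t\<^sub>1} \<and> is_basis t\<^sub>1 t\<^sub>2 \<and> b \<noteq> 0 \<and>
        (\<forall>\<epsilon>>0. \<exists>u. \<exists>M::nat. infinitesimal_flex G u \<and> M > 0 \<and>
           (\<forall>\<omega>. norm \<omega> = 1 \<longrightarrow>
              infinitesimal_flex G (modulation (phase_field \<omega> t\<^sub>1 (real M *\<^sub>R t\<^sub>2)) u)) \<and>
           (\<forall>\<omega>. norm \<omega> = 1 \<longrightarrow>
              mostly_close (joints G) \<epsilon>
                (modulation (phase_field \<omega> t\<^sub>1 (real M *\<^sub>R t\<^sub>2)) u)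
                (modulation (phase_field \<omega> t\<^sub>1 (real M *\<^sub>R t\<^sub>2)) (constant_field b)))))"

text \<open>A line figure is represented as a set of lines; its union is taken where a set of
  points is needed.\<close>

definition periodic_slippage_figure :: "'v framework \<Rightarrow> (real^2) set set" where
  "periodic_slippage_figure G = {H. periodic_slippage_line G H}"

definition reciprocal_figure :: "real^2 \<Rightarrow> real^2 \<Rightarrow> (real^2) set set \<Rightarrow> (real^2) set set" where
  "reciprocal_figure a\<^sub>1 a\<^sub>2 F =
     {span {vector [\<beta>, - \<alpha>]} | \<alpha> \<beta>. span {\<alpha> *\<^sub>R a\<^sub>1 + \<beta> *\<^sub>R a\<^sub>2} \<in> F}"

definition slippage_spectrum :: "'v framework \<Rightarrow> real^2 \<Rightarrow> real^2 \<Rightarrow> (real^2) set" where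
  "slippage_spectrum G a\<^sub>1 a\<^sub>2 = \<Union> (reciprocal_figure a\<^sub>1 a\<^sub>2 (periodic_slippage_figure G))"

definition slippage_spectrum_log :: "'v framework \<Rightarrow> real^2 \<Rightarrow> real^2 \<Rightarrow> (real^2) set" where
  "slippage_spectrum_log G a\<^sub>1 a\<^sub>2 = reduce_mod1 ` slippage_spectrum G a\<^sub>1 a\<^sub>2"


section \<open>Multigrids and their dual tilings\<close>

text \<open>The data of a multigrid with \<open>r\<close> component grids are sequences of which only
  the entries with index \<open>j < r\<close> matter.\<close>

record multigrid =
  num_grids :: nat
  normal :: "nat \<Rightarrow> real^2"
  spacing :: "nat \<Rightarrow> real"
  shift :: "nat \<Rightarrow> real"

definition is_multigrid :: "multigrid \<Rightarrow> bool" where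
  "is_multigrid D \<longleftrightarrow>
     num_grids D \<ge> 2 \<and>
     (\<forall>j<num_grids D. norm (normal D j) = 1 \<and> spacing D j > 0) \<and>
     (\<forall>i<num_grids D. \<forall>j<num_grids D. i \<noteq> j \<longrightarrow> \<not> collinear {0, normal D i, normal D j})"

definition grid_line :: "multigrid \<Rightarrow> nat \<Rightarrow> int \<Rightarrow> (real^2) set" where
  "grid_line D j k = {x. x \<bullet> normal D j + shift D j = of_int k * spacing D j}"

definition grid_lines :: "multigrid \<Rightarrow> (real^2) set set" where
  "grid_lines D = {grid_line D j k | j k. j < num_grids D}"

definition regular_multigrid :: "multigrid \<Rightarrow> bool" where
  "regular_multigrid D \<longleftrightarrow>
     is_multigrid D \<and> (\<forall>x. finite {L \<in> grid_lines D. x \<in> L} \<and> card {L \<in> grid_lines D. x \<in> L} \<le> 2)"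

definition grid_cells :: "multigrid \<Rightarrow> (real^2) set set" where
  "grid_cells D = components (- \<Union> (grid_lines D))"

definition grid_index :: "multigrid \<Rightarrow> nat \<Rightarrow> real^2 \<Rightarrow> int" where
  "grid_index D j x = \<lceil>(x \<bullet> normal D j + shift D j) / spacing D j\<rceil>"

text \<open>The edge vectors are \<open>len j *\<^sub>R normal D j\<close>. The grid indices are constant on each cell,
  so the point chosen in the cell is immaterial.\<close>

definition cell_vertex :: "multigrid \<Rightarrow> (nat \<Rightarrow> real) \<Rightarrow> (real^2) set \<Rightarrow> real^2" where
  "cell_vertex D len C =
     (let x = (SOME x. x \<in> C)
      in \<Sum>j<num_grids D. of_int (grid_index D j x) *\<^sub>R (len j *\<^sub>R normal D j))"

definition adjacent_cells :: "multigrid \<Rightarrow> (real^2) set \<Rightarrow> (real^2) set \<Rightarrow> bool" where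
  "adjacent_cells D C C' \<longleftrightarrow>
     C \<in> grid_cells D \<and> C' \<in> grid_cells D \<and> C \<noteq> C' \<and>
     (\<exists>j<num_grids D. \<exists>k p q. p \<noteq> q \<and>
        closed_segment p q \<subseteq> frontier C \<inter> frontier C' \<inter> grid_line D j k)"

text \<open>Distinct cells have distinct vertices, so the vertices of the tiling serve as the vertices
  of the underlying graph, placed by the identity.\<close>

definition parallelogram_framework :: "multigrid \<Rightarrow> (nat \<Rightarrow> real) \<Rightarrow> (real^2) framework" where
  "parallelogram_framework D len =
     \<lparr> verts = cell_vertex D len ` grid_cells D,
       edges = {{cell_vertex D len C, cell_vertex D len C'} | C C'. adjacent_cells D C C'},
       place = id \<rparr>"

end

theory Submission
  imports Defs
begin

text \<open>Crossing a line of the \<open>j\<close>-th grid changes only the \<open>j\<close>-th grid index of a cell, and opposite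
  edges of a parallelogram have equal velocity differences under a flex, so these differences depend
  only on the grid line crossed (the ribbon). A period \<open>k\<^sub>1 a\<^sub>1 + k\<^sub>2 a\<^sub>2\<close> of the tiling shifts the
  \<open>j\<close>-th index by a linear form \<open>k\<^sub>1 m\<^sub>1 + k\<^sub>2 m\<^sub>2\<close>, with \<open>m = (m\<^sub>1, m\<^sub>2) \<noteq> 0\<close> depending on \<open>j\<close>.
  Both spectra are described by these vectors.

  If a phase-periodic flex is not constant, some velocity difference on a ribbon is nonzero; it is
  invariant under the periods in the kernel of \<open>m\<close>, which forces the phase into \<open>\<real> m + \<int>\<^sup>2\<close>.
  Conversely \<open>exp (2 \<pi> i c K\<^sub>j)\<close> times the direction orthogonal to the \<open>j\<close>-th edge vector is a flex with
  phase \<open>c m\<close>.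

  The ribbons of the \<open>j\<close>-th grid are periodic under \<open>m\<^sub>2 a\<^sub>1 - m\<^sub>1 a\<^sub>2\<close>, and a flex supported on the
  ribbons inside the bands shows that this is a slippage direction. Along a direction transversal to
  all ribbons there is no slippage: a ribbon then meets bands with different phases, and comparing the
  velocity differences as Laurent polynomials in the phase shows that the flex vanishes.\<close>

section \<open>Plane linear algebra and phase fields\<close>

text \<open>Periodicity is assumed of the framework only: nothing says that a period comes from a
  symmetry of the multigrid. Grid indices are therefore carried over to the joints as
  \<open>label\<close>, and a period is shown to shift each label by a constant by moving from joint
  to joint along edges. All such arguments rest on \<open>edge_invariant_imp_constant\<close>.

  The ceiling is left-continuous, so on a grid line \<open>vertex\<close> takes the value of the
  cell on the lower side. This lets an edge be encoded by a point \<open>p\<close> on exactly one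
  line, with ends \<open>vertex p\<close> and \<open>vertex p + edge_vec j\<close>. Regularity
  ensures that a crossing involves only two lines, so that its tile is a parallelogram.

  For slippage along ribbons the obstacle is that bands are straight and ribbons are not: a phase
  jump at a band boundary would strain the bars near it. A ribbon stays within bounded height of its
  direction, so it is enough to freeze the joints near the boundaries, and wide bands make these
  rare.\<close>

definition cross2 :: "real^2 \<Rightarrow> real^2 \<Rightarrow> real" where
  "cross2 x y = x $ 1 * y $ 2 - x $ 2 * y $ 1"

definition perp :: "real^2 \<Rightarrow> real^2" where
  "perp x = vector [- x $ 2, x $ 1]"

lemma vec2_eq_iff: "x = y \<longleftrightarrow> x $ 1 = y $ 1 \<and> x $ 2 = (y :: 'a^2) $ 2"
  by (simp add: vec_eq_iff forall_2)

lemma inner2: "x \<bullet> y = x $ 1 * y $ 1 + x $ 2 * (y :: real^2) $ 2"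
  by (simp add: inner_vec_def sum_2)

lemma perp_nth [simp]: "perp x $ 1 = - x $ 2" "perp x $ 2 = x $ 1"
  by (simp_all add: perp_def)

lemma perp_inner [simp]: "perp x \<bullet> x = 0" "x \<bullet> perp x = 0"
  by (simp_all add: inner2)

lemma perp_inner_cross2: "perp x \<bullet> y = cross2 x y"
  by (simp add: inner2 cross2_def)

lemma perp_eq_0_iff [simp]: "perp x = 0 \<longleftrightarrow> x = 0"
  by (auto simp: vec2_eq_iff)

lemma cross2_add: "cross2 x (y + z) = cross2 x y + cross2 x z"
  and cross2_diff: "cross2 x (y - z) = cross2 x y - cross2 x z"
  and cross2_scale: "cross2 x (c *\<^sub>R y) = c * cross2 x y"
  and cross2_add_left: "cross2 (y + z) x = cross2 y x + cross2 z x"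
  and cross2_diff_left: "cross2 (y - z) x = cross2 y x - cross2 z x"
  and cross2_scale_left: "cross2 (c *\<^sub>R y) x = c * cross2 y x"
  by (simp_all add: cross2_def algebra_simps)

lemmas cross2_linear = cross2_add cross2_diff cross2_scale
  cross2_add_left cross2_diff_left cross2_scale_left

lemma cross2_self [simp]: "cross2 x x = 0"
  by (simp add: cross2_def)

lemma cross2_swap: "cross2 y x = - cross2 x y"
  by (simp add: cross2_def)

text \<open>Cramer's rule.\<close>

lemma cross2_expand:
  assumes "cross2 a b \<noteq> 0"
  shows "x = (cross2 x b / cross2 a b) *\<^sub>R a + (cross2 a x / cross2 a b) *\<^sub>R b"
proof -
  have "cross2 a b *\<^sub>R x = cross2 x b *\<^sub>R a + cross2 a x *\<^sub>R b"
    by (simp add: vec2_eq_iff cross2_def algebra_simps)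
  then have "(1 / cross2 a b) *\<^sub>R (cross2 a b *\<^sub>R x)
      = (1 / cross2 a b) *\<^sub>R (cross2 x b *\<^sub>R a + cross2 a x *\<^sub>R b)"
    by simp
  then show ?thesis
    using assms by (simp add: scaleR_add_right)
qed

lemma cross2_eq_0_imp_multiple:
  assumes "cross2 a b = 0" "a \<noteq> 0"
  shows "\<exists>c. b = c *\<^sub>R a"
proof (intro exI)
  have n: "a $ 1 * a $ 1 + a $ 2 * a $ 2 \<noteq> 0"
    using assms(2) by (auto simp: vec2_eq_iff add_nonneg_eq_0_iff)
  have e: "a $ 1 * b $ 2 = a $ 2 * b $ 1"
    using assms(1) by (simp add: cross2_def)
  have "b $ 1 * (a $ 1 * a $ 1 + a $ 2 * a $ 2) = (a \<bullet> b) * a $ 1"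
    using e by (simp add: inner2 algebra_simps)
  moreover have "b $ 2 * (a $ 1 * a $ 1 + a $ 2 * a $ 2) = (a \<bullet> b) * a $ 2"
    using e by (simp add: inner2) algebra
  ultimately show "b = (a \<bullet> b / (a \<bullet> a)) *\<^sub>R a"
    using n by (simp add: vec2_eq_iff inner2[of a a] nonzero_eq_divide_eq)
qed

lemma not_collinear_imp_cross2:
  assumes "\<not> collinear {0, a, b}"
  shows "cross2 a b \<noteq> 0"
  using assms cross2_eq_0_imp_multiple[of a b] by (auto simp: collinear_lemma)

lemma is_basis_iff_cross2: "is_basis a b \<longleftrightarrow> cross2 a b \<noteq> 0"
proof
  assume B: "is_basis a b"
  show "cross2 a b \<noteq> 0"
  proof
    assume c: "cross2 a b = 0"
    have "a \<noteq> 0"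
      using B dependent_zero[of "{a, b}"] by (auto simp: is_basis_def)
    \<comment> \<open>The span consists of multiples of \<open>a\<close>, and \<open>perp a\<close>
      is not one of them.\<close>
    have "span {a, b} \<subseteq> {x. cross2 a x = 0}"
      by (rule span_minimal) (auto simp: c subspace_def cross2_linear, simp add: cross2_def)
    then have "cross2 a (perp a) = 0"
      using B by (auto simp: is_basis_def)
    then have "a $ 1 * a $ 1 + a $ 2 * a $ 2 = 0"
      by (simp add: cross2_def)
    then show False
      using \<open>a \<noteq> 0\<close> by (auto simp: vec2_eq_iff add_nonneg_eq_0_iff)
  qed
next
  assume c: "cross2 a b \<noteq> 0"
  have "x \<in> span {a, b}" for x
    using cross2_expand[OF c, of x]
    by (metis insertI1 insertI2 span_add span_base span_scale)
  moreover have "independent {a, b}"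
  proof -
    have "b \<noteq> 0" using c by (auto simp: cross2_def)
    moreover have "a \<notin> span {b}"
      using c by (auto simp: span_singleton cross2_linear)
    ultimately show ?thesis
      by (simp add: independent_insert)
  qed
  ultimately show "is_basis a b"
    by (auto simp: is_basis_def)
qed

section \<open>Complex velocities and phase fields\<close>

lemma pairing_diff: "pairing (x - y) z = pairing x z - pairing y z"
  and pairing_smult: "pairing (c *s x) z = c * pairing x z"
  and pairing_minus_right: "pairing x (- z) = - pairing x z"
  by (simp_all add: pairing_def sum_2 algebra_simps)

lemma pairing_constant_field: "pairing (constant_field b y) x = of_real (b \<bullet> x)"
  by (simp add: pairing_def constant_field_def inner2 sum_2)

text \<open>A linear system with real coefficients and complex unknowns, solved through its nonzero
  determinant.\<close>

lemma pairing_eq_0_imp: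
  assumes "cross2 x y \<noteq> 0" "pairing z x = 0" "pairing z y = 0"
  shows "z = 0"
proof -
  have 1: "z $ 1 * of_real (x $ 1) + z $ 2 * of_real (x $ 2) = 0"
    and 2: "z $ 1 * of_real (y $ 1) + z $ 2 * of_real (y $ 2) = 0"
    using assms by (simp_all add: pairing_def sum_2)
  have "z $ 1 * of_real (cross2 x y) = 0" "z $ 2 * of_real (cross2 x y) = 0"
    using 1 2 by (simp_all add: cross2_def; algebra)+
  then show ?thesis
    using assms(1) by (simp add: vec2_eq_iff)
qed

lemma constant_field_eq_0_iff [simp]: "constant_field b x = 0 \<longleftrightarrow> b = 0"
  by (simp add: constant_field_def vec_eq_iff)

text \<open>By Cramer's rule the quotient is the coordinate of \<open>x\<close> along
  \<open>t\<close>, so the definite description denotes its floor.\<close>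

lemma phase_field_eq:
  assumes "cross2 s t \<noteq> 0"
  shows "phase_field \<omega> s t x = \<omega> powi \<lfloor>cross2 s x / cross2 s t\<rfloor>"
proof -
  have "(\<exists>s\<^sub>1 s\<^sub>2. x = s\<^sub>1 *\<^sub>R s + s\<^sub>2 *\<^sub>R t \<and> of_int k \<le> s\<^sub>2 \<and> s\<^sub>2 < of_int k + 1)
      \<longleftrightarrow> k = \<lfloor>cross2 s x / cross2 s t\<rfloor>" for k
  proof
    assume "\<exists>s\<^sub>1 s\<^sub>2. x = s\<^sub>1 *\<^sub>R s + s\<^sub>2 *\<^sub>R t \<and> of_int k \<le> s\<^sub>2 \<and> s\<^sub>2 < of_int k + 1"
    then obtain s1 s2 where x: "x = s1 *\<^sub>R s + s2 *\<^sub>R t" and k: "of_int k \<le> s2" "s2 < of_int k + 1"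
      by blast
    have "cross2 s x / cross2 s t = s2"
      using assms by (simp add: x cross2_linear)
    then show "k = \<lfloor>cross2 s x / cross2 s t\<rfloor>"
      using k by (simp add: floor_unique)
  next
    assume "k = \<lfloor>cross2 s x / cross2 s t\<rfloor>"
    then have "of_int k \<le> cross2 s x / cross2 s t" "cross2 s x / cross2 s t < of_int k + 1"
      by (simp_all add: floor_correct)
    then show "\<exists>s\<^sub>1 s\<^sub>2. x = s\<^sub>1 *\<^sub>R s + s\<^sub>2 *\<^sub>R t \<and> of_int k \<le> s\<^sub>2 \<and> s\<^sub>2 < of_int k + 1"
      using cross2_expand[OF assms, of x] by blast
  qed
  then show ?thesis
    by (simp add: phase_field_def)
qed

text \<open>Divided by the lowest power, both sides become polynomials that agree on the infinite
  unit circle and so have equal coefficients. All exponents on the left lie below all those on the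
  right, hence every coefficient is zero. The exponents \<open>a\<close> and \<open>b\<close> may
  coincide, so only the difference vanishes, not \<open>A\<close> and \<open>B\<close>.\<close>

lemma laurent_low_part_eq_0:
  fixes A B C E :: complex and a b c d :: int
  assumes eq: "\<And>\<omega>. norm \<omega> = 1 \<Longrightarrow> A * \<omega> powi a - B * \<omega> powi b = C * \<omega> powi c - E * \<omega> powi d"
    and lt: "a < c" "b < c" "a < d" "b < d" and \<omega>: "norm \<omega> = 1"
  shows "A * \<omega> powi a - B * \<omega> powi b = 0"
proof -
  define l where "l = min a b"
  define P where "P = monom A (nat (a - l)) - monom B (nat (b - l))"
  define R where "R = monom C (nat (c - l)) - monom E (nat (d - l))"
  have pw: "z powi k = z powi l * z ^ nat (k - l)" if "z \<noteq> 0" "l \<le> k" for z :: complex and k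
    using that power_int_add[of z l "k - l"] by (simp add: power_int_def)
  have nz: "z \<noteq> 0" if "norm z = 1" for z :: complex
    using that by auto
  have le: "l \<le> a" "l \<le> b" "l \<le> c" "l \<le> d"
    using lt by (auto simp: l_def)
  have Pz: "z powi l * poly P z = A * z powi a - B * z powi b" if "norm z = 1" for z
    by (simp add: P_def poly_monom algebra_simps pw[OF nz[OF that] le(1)] pw[OF nz[OF that] le(2)])
  have Rz: "z powi l * poly R z = C * z powi c - E * z powi d" if "norm z = 1" for z
    by (simp add: R_def poly_monom algebra_simps pw[OF nz[OF that] le(3)] pw[OF nz[OF that] le(4)])
  have "poly (P - R) z = 0" if "norm z = 1" for z
  proof -
    have "z powi l * poly P z = z powi l * poly R z"
      using Pz[OF that] Rz[OF that] eq[OF that] by simp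
    then show ?thesis
      using nz[OF that] by simp
  qed
  then have "sphere 0 1 \<subseteq> {z. poly (P - R) z = 0}"
    by auto
  moreover have "infinite (sphere (0::complex) 1)"
    using connected_uncountable[of "sphere (0::complex) 1" 1 "-1"] connected_sphere[of "0::complex" 1]
    by (auto dest: countable_finite)
  ultimately have "P - R = 0"
    using poly_roots_finite finite_subset by blast
  then have PR: "P = R" by simp
  have "coeff P n = 0" for n
  proof (cases "n < nat (min c d - l)")
    case True
    then have "coeff R n = 0"
      by (auto simp: R_def)
    then show ?thesis using PR by simp
  next
    case False
    then show ?thesis
      using lt le by (auto simp: P_def)
  qed
  then have "P = 0"
    by (simp add: poly_eq_iff)
  then show ?thesis
    using Pz[OF \<omega>] by simp
qed

section \<open>Local behaviour of ceilings, and local constancy\<close>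

lemma eventually_ceiling:
  fixes z :: real
  shows "eventually (\<lambda>y. \<lceil>y\<rceil> = (if z \<in> \<int> \<and> y > z then \<lceil>z\<rceil> + 1 else \<lceil>z\<rceil>)) (nhds z)"
proof (cases "z \<in> \<int>")
  case True
  then obtain k where k: "z = of_int k" by (auto elim: Ints_cases)
  have "eventually (\<lambda>y. y \<in> {z - 1 <..< z + 1}) (nhds z)"
    by (rule eventually_nhds_in_open) auto
  then show ?thesis
    by eventually_elim (use k in \<open>auto simp: ceiling_eq_iff\<close>)
next
  case False
  have "eventually (\<lambda>y. y \<in> {of_int \<lceil>z\<rceil> - 1 <..< of_int \<lceil>z\<rceil>}) (nhds z)"
  proof (rule eventually_nhds_in_open)
    have "z \<noteq> of_int \<lceil>z\<rceil>" using False by (metis Ints_of_int)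
    then show "z \<in> {of_int \<lceil>z\<rceil> - 1 <..< of_int \<lceil>z\<rceil>}"
      using le_of_int_ceiling[of z] by (simp add: less_le) linarith
  qed auto
  then show ?thesis
    by eventually_elim (use False in \<open>auto simp: ceiling_eq_iff\<close>)
qed

lemma eventually_Ints_imp_eq:
  fixes z :: real
  shows "eventually (\<lambda>y. y \<in> \<int> \<longrightarrow> y = z) (nhds z)"
proof -
  have "closed (\<int> - {z})"
    by (rule closed_subset_Ints) auto
  then have "eventually (\<lambda>y. y \<in> - (\<int> - {z})) (nhds z)"
    by (intro eventually_nhds_in_open open_Compl) auto
  then show ?thesis
    by eventually_elim auto
qed

lemma closure_eventually:
  assumes "x \<in> closure A" "eventually P (nhds x)"
  shows "\<exists>y\<in>A. P y"
proof -
  obtain S where "open S" "x \<in> S" "\<forall>y\<in>S. P y"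
    using assms(2) by (auto simp: eventually_nhds)
  moreover then have "S \<inter> A \<noteq> {}"
    using assms(1) open_Int_closure_eq_empty[of S A] by blast
  ultimately show ?thesis by blast
qed

text \<open>Phrased with \<open>nhds\<close> so that \<open>eventually_near\<close> supplies the
  local hypothesis directly.\<close>

lemma locally_constant_imp_eq:
  assumes "connected S" "\<And>x. x \<in> S \<Longrightarrow> eventually (\<lambda>y. y \<in> S \<longrightarrow> f y = f x) (nhds x)"
    and "x \<in> S" "y \<in> S"
  shows "f x = f y"
proof -
  have "f constant_on S"
  proof (rule locally_constant_imp_constant[OF assms(1)])
    fix a assume a: "a \<in> S"
    then obtain T where "open T" "a \<in> T" "\<forall>y\<in>T. y \<in> S \<longrightarrow> f y = f a"
      using assms(2)[OF a] by (auto simp: eventually_nhds)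
    then show "\<exists>T. openin (top_of_set S) T \<and> a \<in> T \<and> (\<forall>x\<in>T. f x = f a)"
      using a openin_open_Int[of T S] by blast
  qed
  then show ?thesis using assms(3,4) by (auto simp: constant_on_def)
qed

lemma lattice_vector_near:
  assumes "cross2 a\<^sub>1 a\<^sub>2 \<noteq> 0"
  shows "\<exists>k\<^sub>1 k\<^sub>2. norm (x - lattice_vector a\<^sub>1 a\<^sub>2 k\<^sub>1 k\<^sub>2) \<le> norm a\<^sub>1 + norm a\<^sub>2"
proof -
  define s where "s = cross2 x a\<^sub>2 / cross2 a\<^sub>1 a\<^sub>2"
  define t where "t = cross2 a\<^sub>1 x / cross2 a\<^sub>1 a\<^sub>2"
  have "x = s *\<^sub>R a\<^sub>1 + t *\<^sub>R a\<^sub>2"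
    unfolding s_def t_def by (rule cross2_expand[OF assms])
  then have "x - lattice_vector a\<^sub>1 a\<^sub>2 \<lfloor>s\<rfloor> \<lfloor>t\<rfloor> = frac s *\<^sub>R a\<^sub>1 + frac t *\<^sub>R a\<^sub>2"
    by (simp add: lattice_vector_def frac_def scaleR_diff_left)
  moreover have "norm (frac s *\<^sub>R a\<^sub>1) \<le> 1 * norm a\<^sub>1" "norm (frac t *\<^sub>R a\<^sub>2) \<le> 1 * norm a\<^sub>2"
    unfolding norm_scaleR by (intro mult_right_mono; simp add: frac_ge_0 less_imp_le[OF frac_lt_1])+
  ultimately show ?thesis
    using norm_triangle_ineq[of "frac s *\<^sub>R a\<^sub>1" "frac t *\<^sub>R a\<^sub>2"]
    by (intro exI[of _ "\<lfloor>s\<rfloor>"] exI[of _ "\<lfloor>t\<rfloor>"]) simp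
qed

lemma exp_2pi_eq_1_iff: "exp (\<i> * complex_of_real (2 * pi * x)) = 1 \<longleftrightarrow> x \<in> \<int>"
proof -
  have "exp (\<i> * complex_of_real (2 * pi * x)) = 1 \<longleftrightarrow> (\<exists>n::int. 2 * pi * x = real_of_int (2 * n) * pi)"
    by (simp add: exp_eq_1)
  also have "\<dots> \<longleftrightarrow> x \<in> \<int>"
    by (auto simp: Ints_def)
  finally show ?thesis .
qed

lemma mem_square_iff:
  fixes x :: "real^2"
  shows "x \<in> (+) c ` cbox (vec (- N)) (vec N) \<longleftrightarrow> (\<forall>i. \<bar>x $ i - c $ i\<bar> \<le> N)"
proof -
  have "x \<in> (+) c ` A \<longleftrightarrow> x - c \<in> A" for A
    by (auto intro!: image_eqI[of _ _ "x - c"])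
  moreover have "- N \<le> y \<and> y \<le> N \<longleftrightarrow> \<bar>y\<bar> \<le> N" for y
    by linarith
  ultimately show ?thesis
    by (simp add: mem_box_cart)
qed

section \<open>The dual tiling of a regular multigrid\<close>

locale parallelogram_tiling =
  fixes D :: multigrid and len :: "nat \<Rightarrow> real"
  assumes regular: "regular_multigrid D"
    and len_pos: "j < num_grids D \<Longrightarrow> len j > 0"
begin

definition coord :: "nat \<Rightarrow> real^2 \<Rightarrow> real" where
  "coord j x = (x \<bullet> normal D j + shift D j) / spacing D j"

definition edge_vec :: "nat \<Rightarrow> real^2" where
  "edge_vec j = len j *\<^sub>R normal D j"

definition vertex :: "real^2 \<Rightarrow> real^2" where
  "vertex x = (\<Sum>j<num_grids D. of_int (grid_index D j x) *\<^sub>R edge_vec j)"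

definition off_grid :: "(real^2) set" where
  "off_grid = {x. \<forall>j<num_grids D. coord j x \<notin> \<int>}"

definition only_on_grid :: "nat \<Rightarrow> real^2 \<Rightarrow> bool" where
  "only_on_grid j x \<longleftrightarrow> j < num_grids D \<and> coord j x \<in> \<int> \<and> (\<forall>i<num_grids D. i \<noteq> j \<longrightarrow> coord i x \<notin> \<int>)"

lemma two_le_num_grids: "2 \<le> num_grids D"
  and norm_normal: "j < num_grids D \<Longrightarrow> norm (normal D j) = 1"
  and spacing_pos: "j < num_grids D \<Longrightarrow> spacing D j > 0"
  using regular by (auto simp: regular_multigrid_def is_multigrid_def)

lemma cross2_normal:
  "i < num_grids D \<Longrightarrow> j < num_grids D \<Longrightarrow> i \<noteq> j \<Longrightarrow> cross2 (normal D i) (normal D j) \<noteq> 0"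
  using regular by (intro not_collinear_imp_cross2) (auto simp: regular_multigrid_def is_multigrid_def)

lemma cross2_edge_vec:
  "i < num_grids D \<Longrightarrow> j < num_grids D \<Longrightarrow> i \<noteq> j \<Longrightarrow> cross2 (edge_vec i) (edge_vec j) \<noteq> 0"
  using cross2_normal[of i j] len_pos[of i] len_pos[of j] by (simp add: edge_vec_def cross2_linear)

lemma normal_nonzero: "j < num_grids D \<Longrightarrow> normal D j \<noteq> 0"
  using norm_normal[of j] by auto

lemma edge_vec_nonzero: "j < num_grids D \<Longrightarrow> edge_vec j \<noteq> 0"
  using normal_nonzero[of j] len_pos[of j] by (simp add: edge_vec_def)

lemma grid_index_eq_ceiling: "grid_index D j x = \<lceil>coord j x\<rceil>"
  by (simp add: grid_index_def coord_def)

lemma in_grid_line_iff: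
  "j < num_grids D \<Longrightarrow> x \<in> grid_line D j k \<longleftrightarrow> coord j x = of_int k"
  using spacing_pos[of j] by (simp add: grid_line_def coord_def divide_eq_eq)

lemma off_grid_eq: "- \<Union> (grid_lines D) = off_grid"
proof -
  have "x \<in> \<Union> (grid_lines D) \<longleftrightarrow> x \<notin> off_grid" for x
    using in_grid_line_iff by (auto simp: grid_lines_def off_grid_def Ints_def)
  then show ?thesis
    by blast
qed

lemma coord_add: "coord j (x + y) = coord j x + y \<bullet> normal D j / spacing D j"
  by (simp add: coord_def inner_add_left add_divide_distrib)

lemma continuous_coord [continuous_intros]: "continuous_on A (coord j)"
  unfolding coord_def divide_inverse by (intro continuous_intros)

lemma isCont_coord: "isCont (coord j) x"
  using continuous_coord[of UNIV] by (simp add: continuous_on_eq_continuous_at)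

lemma coord_eq_imp_eq:
  assumes "i < num_grids D" "j < num_grids D" "i \<noteq> j" "coord i x = coord i y" "coord j x = coord j y"
  shows "x = y"
proof -
  have "(x - y) \<bullet> normal D i = 0" "(x - y) \<bullet> normal D j = 0"
    using assms spacing_pos[of i] spacing_pos[of j] by (simp_all add: coord_def inner_diff_left)
  moreover have "cross2 (normal D i) (normal D j) \<noteq> 0"
    using assms cross2_normal by blast
  ultimately have "(x - y) \<bullet> z = 0" for z
    by (subst cross2_expand[of "normal D i" "normal D j" z]) (simp_all add: inner_add_right)
  then have "(x - y) \<bullet> (x - y) = 0" .
  then show ?thesis by simp
qed

text \<open>Regularity counts lines as sets, so lines of different grids must first be shown to
  differ: a step along a line of one grid changes the coordinate of any other grid.\<close>

lemma at_most_two_grids: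
  assumes "i < num_grids D" "j < num_grids D" "l < num_grids D" "i \<noteq> j" "i \<noteq> l" "j \<noteq> l"
    and "coord i x \<in> \<int>" "coord j x \<in> \<int>"
  shows "coord l x \<notin> \<int>"
proof
  assume "coord l x \<in> \<int>"
  then obtain ki kj kl where k: "coord i x = of_int ki" "coord j x = of_int kj" "coord l x = of_int kl"
    using assms by (auto elim!: Ints_cases)
  have ne: "grid_line D a k \<noteq> grid_line D b k'"
    if "a < num_grids D" "b < num_grids D" "a \<noteq> b" "x \<in> grid_line D a k" for a b k k'
  proof
    assume eq: "grid_line D a k = grid_line D b k'"
    define y where "y = x + perp (normal D a)"
    have "coord a y = coord a x"
      by (simp add: y_def coord_add)
    then have "y \<in> grid_line D a k"
      using that by (simp add: in_grid_line_iff)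
    then have "coord b y = coord b x"
      using that eq in_grid_line_iff by metis
    then have "y = x"
      using \<open>coord a y = coord a x\<close> coord_eq_imp_eq that by blast
    then show False
      using normal_nonzero that by (simp add: y_def)
  qed
  have x: "x \<in> grid_line D i ki" "x \<in> grid_line D j kj" "x \<in> grid_line D l kl"
    using k assms by (simp_all add: in_grid_line_iff)
  let ?S = "{grid_line D i ki, grid_line D j kj, grid_line D l kl}"
  have "card ?S = 3"
    using ne x assms by (simp add: card_insert_if)
  moreover have "?S \<subseteq> {L \<in> grid_lines D. x \<in> L}"
    using x assms by (auto simp: grid_lines_def)
  moreover have "finite {L \<in> grid_lines D. x \<in> L}" "card {L \<in> grid_lines D. x \<in> L} \<le> 2"
    using regular by (auto simp: regular_multigrid_def)
  ultimately show False
    using card_mono[of "{L \<in> grid_lines D. x \<in> L}" ?S] by simp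
qed

text \<open>By left-continuity of the ceiling an index jumps only on the upper side of a line
  through \<open>x\<close>. The second conjunct excludes all lines that do not pass through
  \<open>x\<close>.\<close>

lemma eventually_near:
  "eventually (\<lambda>y. \<forall>j<num_grids D.
      grid_index D j y = grid_index D j x + (if coord j x \<in> \<int> \<and> coord j y > coord j x then 1 else 0) \<and>
      (coord j y \<in> \<int> \<longrightarrow> coord j y = coord j x)) (nhds x)"
proof -
  have *: "filterlim (coord j) (nhds (coord j x)) (nhds x)" for j
    using isCont_coord[of x j] by (simp add: continuous_at tendsto_at_iff_tendsto_nhds)
  have "eventually (\<lambda>y. \<forall>j\<in>{..<num_grids D}.
      grid_index D j y = grid_index D j x + (if coord j x \<in> \<int> \<and> coord j y > coord j x then 1 else 0) \<and>
      (coord j y \<in> \<int> \<longrightarrow> coord j y = coord j x)) (nhds x)"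
  proof (rule eventually_ball_finite, simp, intro ballI eventually_conj)
    fix j
    show "eventually (\<lambda>y. grid_index D j y = grid_index D j x +
        (if coord j x \<in> \<int> \<and> coord j y > coord j x then 1 else 0)) (nhds x)"
      using filterlim_iff[THEN iffD1, OF *, rule_format, OF eventually_ceiling, of j]
      by (rule eventually_mono) (simp add: grid_index_eq_ceiling split: if_splits)
    show "eventually (\<lambda>y. coord j y \<in> \<int> \<longrightarrow> coord j y = coord j x) (nhds x)"
      using filterlim_iff[THEN iffD1, OF *, rule_format, OF eventually_Ints_imp_eq, of j] .
  qed
  then show ?thesis
    by (rule eventually_mono) blast
qed

subsection \<open>Cells\<close>

definition cell_of :: "real^2 \<Rightarrow> (real^2) set" where
  "cell_of x = {y \<in> off_grid. \<forall>j<num_grids D. grid_index D j y = grid_index D j x}"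

lemma cell_of_self: "x \<in> off_grid \<Longrightarrow> x \<in> cell_of x"
  by (simp add: cell_of_def)

text \<open>Off the grid both ceiling inequalities are strict, so the set is an intersection of open
  half-planes and thus convex.\<close>

lemma connected_cell_of: "connected (cell_of x)"
proof -
  have "cell_of x = (\<Inter>j<num_grids D.
      {y. normal D j \<bullet> y > (of_int (grid_index D j x) - 1) * spacing D j - shift D j} \<inter>
      {y. normal D j \<bullet> y < of_int (grid_index D j x) * spacing D j - shift D j})" (is "_ = ?R")
  proof (intro set_eqI)
    fix y
    have "coord j y \<notin> \<int> \<and> grid_index D j y = k \<longleftrightarrow> normal D j \<bullet> y > (of_int k - 1) * spacing D j - shift D j
        \<and> normal D j \<bullet> y < of_int k * spacing D j - shift D j" (is "?a \<longleftrightarrow> ?b")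
      if "j < num_grids D" for j k
    proof -
      have "?b \<longleftrightarrow> of_int k - 1 < coord j y \<and> coord j y < of_int k"
        using spacing_pos[OF that] by (auto simp: coord_def field_simps inner_commute)
      moreover have "\<dots> \<longleftrightarrow> ?a"
      proof
        assume c: "of_int k - 1 < coord j y \<and> coord j y < of_int k"
        have "coord j y \<notin> \<int>"
        proof
          assume "coord j y \<in> \<int>"
          then obtain m where "coord j y = of_int m" by (auto elim: Ints_cases)
          then have "of_int (k - 1) < (of_int m :: real)" "of_int m < (of_int k :: real)" using c by auto
          then have "k - 1 < m" "m < k" by (simp_all only: of_int_less_iff)
          then show False by simp
        qed
        then show ?a using c by (auto simp: grid_index_eq_ceiling ceiling_eq_iff)
      next
        assume ?a
        then show "of_int k - 1 < coord j y \<and> coord j y < of_int k"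
          using ceiling_correct[of "coord j y"] Ints_of_int[of k, where 'a = real]
          by (auto simp: grid_index_eq_ceiling less_le simp del: Ints_of_int)
      qed
      ultimately show ?thesis by blast
    qed
    then show "y \<in> cell_of x \<longleftrightarrow> y \<in> ?R"
      by (auto simp: cell_of_def off_grid_def)
  qed
  moreover have "convex ?R"
    by (intro convex_INT ballI convex_Int convex_halfspace_gt convex_halfspace_lt)
  ultimately show ?thesis
    by (simp add: convex_connected)
qed

lemma connected_component_off_grid:
  assumes x: "x \<in> off_grid"
  shows "connected_component_set off_grid x = cell_of x"
proof
  show "cell_of x \<subseteq> connected_component_set off_grid x"
    by (rule connected_component_maximal) (use x connected_cell_of cell_of_self in \<open>auto simp: cell_of_def\<close>)
  show "connected_component_set off_grid x \<subseteq> cell_of x"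
  proof
    fix y assume y: "y \<in> connected_component_set off_grid x"
    let ?C = "connected_component_set off_grid x"
    have sub: "?C \<subseteq> off_grid" by (rule connected_component_subset)
    have conn: "connected (coord j ` ?C)" for j
      by (intro connected_continuous_image continuous_coord) simp
    have xC: "x \<in> ?C" using x by (simp add: connected_component_refl)
    \<comment> \<open>If the ceiling were larger at \<open>z\<close> than at \<open>w\<close>, then
      by connectedness the coordinate would attain the integer
      \<open>\<lceil>coord j w\<rceil>\<close> inside the component, on a grid line.\<close>
    have "\<lceil>coord j z\<rceil> \<le> \<lceil>coord j w\<rceil>" if "z \<in> ?C" "w \<in> ?C" "j < num_grids D" for z w j
    proof (rule ccontr)
      assume "\<not> ?thesis"
      then have "coord j w \<le> of_int \<lceil>coord j w\<rceil>" "of_int \<lceil>coord j w\<rceil> \<le> coord j z"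
        by linarith+
      then have "of_int \<lceil>coord j w\<rceil> \<in> coord j ` ?C"
        using connectedD_interval[OF conn, of "coord j w" j "coord j z"] that by blast
      then obtain q where "q \<in> ?C" "coord j q = of_int \<lceil>coord j w\<rceil>"
        by auto
      then have "q \<in> off_grid" "coord j q \<in> \<int>"
        using sub by auto
      then show False
        using that(3) by (simp add: off_grid_def)
    qed
    then show "y \<in> cell_of x"
      using xC y sub by (auto simp: cell_of_def grid_index_eq_ceiling intro: antisym)
  qed
qed

lemma grid_cells_eq: "grid_cells D = cell_of ` off_grid"
  unfolding grid_cells_def off_grid_eq components_def
  using connected_component_off_grid by (auto simp: image_iff)

lemma vertex_cong: "(\<And>j. j < num_grids D \<Longrightarrow> grid_index D j x = grid_index D j y) \<Longrightarrow> vertex x = vertex y"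
  unfolding vertex_def by (rule sum.cong) auto

lemma cell_vertex_cell_of:
  assumes "x \<in> off_grid"
  shows "cell_vertex D len (cell_of x) = vertex x"
proof -
  have "(SOME y. y \<in> cell_of x) \<in> cell_of x"
    using cell_of_self[OF assms] by (rule someI)
  then show ?thesis
    using vertex_cong[of "SOME y. y \<in> cell_of x" x]
    by (simp add: cell_vertex_def Let_def cell_of_def vertex_def edge_vec_def)
qed

section \<open>Edges of the tiling\<close>

lemma vertex_step:
  assumes "j < num_grids D" "\<And>i. i < num_grids D \<Longrightarrow>
    grid_index D i y = grid_index D i x + (if i = j then 1 else 0)"
  shows "vertex y = vertex x + edge_vec j"
proof -
  have "vertex y = (\<Sum>i<num_grids D. of_int (grid_index D i x) *\<^sub>R edge_vec i + (if i = j then edge_vec i else 0))"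
    unfolding vertex_def using assms by (intro sum.cong) (auto simp: scaleR_add_left)
  then show ?thesis
    using assms(1) by (simp add: sum.distrib vertex_def)
qed

text \<open>The two neighbours are \<open>p\<close> moved a little along the normal to either side;
  at \<open>p\<close> itself the ceiling already gives the index of the lower side. Adjacency asks
  for a common boundary segment, and a short piece of the grid line starting at \<open>p\<close>
  serves.\<close>

lemma only_on_grid_neighbours:
  assumes p: "only_on_grid j p"
  obtains x y where "x \<in> off_grid" "y \<in> off_grid" "adjacent_cells D (cell_of x) (cell_of y)"
    "vertex x = vertex p" "vertex y = vertex p + edge_vec j"
    "\<And>i. i < num_grids D \<Longrightarrow> grid_index D i y = grid_index D i p + (if i = j then 1 else 0)"
proof -
  have j: "j < num_grids D" and jp: "coord j p \<in> \<int>"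
    and ip: "\<And>i. i < num_grids D \<Longrightarrow> i \<noteq> j \<Longrightarrow> coord i p \<notin> \<int>"
    using p by (auto simp: only_on_grid_def)
  obtain \<epsilon> where \<epsilon>: "\<epsilon> > 0" and near: "\<And>y i. dist y p < \<epsilon> \<Longrightarrow> i < num_grids D \<Longrightarrow>
      grid_index D i y = grid_index D i p + (if coord i p \<in> \<int> \<and> coord i y > coord i p then 1 else 0) \<and>
      (coord i y \<in> \<int> \<longrightarrow> coord i y = coord i p)"
    using eventually_near[of p] unfolding eventually_nhds_metric by blast
  obtain k where k: "coord j p = of_int k"
    using jp by (auto elim: Ints_cases)
  define n where "n = normal D j"
  have nn: "norm n = 1" "n \<bullet> n = 1"
    using norm_normal[OF j] by (simp_all add: n_def norm_eq_1)
  have s: "spacing D j > 0" using spacing_pos[OF j] .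
  define q where "q = p + (\<epsilon> / 2) *\<^sub>R perp n"
  have np: "norm (perp n) = 1"
    using nn(2) by (simp add: norm_eq_1 inner2 algebra_simps)
  have seg: "coord j z = coord j p \<and> dist z p \<le> \<epsilon> / 2" if zs: "z \<in> closed_segment p q" for z
  proof -
    obtain u where u: "0 \<le> u" "u \<le> 1" and "z = (1 - u) *\<^sub>R p + u *\<^sub>R q"
      using zs by (auto simp: in_segment)
    then have z: "z = p + (u * (\<epsilon> / 2)) *\<^sub>R perp n"
      by (simp add: q_def scaleR_add_right scaleR_diff_left)
    have "u * (\<epsilon> / 2) \<le> 1 * (\<epsilon> / 2)"
      using u \<epsilon> by (intro mult_right_mono) auto
    then show ?thesis
      using u \<epsilon> np by (simp add: z coord_add n_def[symmetric] dist_norm)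
  qed
  have side: "coord j (z + \<delta> *\<^sub>R n) = coord j p + \<delta> / spacing D j \<and> dist (z + \<delta> *\<^sub>R n) p < \<epsilon>"
    if "z \<in> closed_segment p q" "\<bar>\<delta>\<bar> < \<epsilon> / 2" for z \<delta>
  proof -
    have "dist (z + \<delta> *\<^sub>R n) p \<le> dist (z + \<delta> *\<^sub>R n) z + dist z p"
      by (rule dist_triangle)
    then have "dist (z + \<delta> *\<^sub>R n) p < \<epsilon>"
      using seg[OF that(1)] that(2) nn by (simp add: dist_norm)
    then show ?thesis
      using seg[OF that(1)] nn by (simp add: coord_add n_def[symmetric])
  qed
  define x where "x = p - (\<epsilon> / 4) *\<^sub>R n"
  define y where "y = p + (\<epsilon> / 4) *\<^sub>R n"
  have up: "z + \<delta> *\<^sub>R n \<in> off_grid \<and> (\<forall>i<num_grids D. grid_index D i (z + \<delta> *\<^sub>R n) =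
      grid_index D i p + (if i = j \<and> \<delta> > 0 then 1 else 0))"
    if "z \<in> closed_segment p q" "\<bar>\<delta>\<bar> < \<epsilon> / 2" "\<delta> \<noteq> 0" for z \<delta>
  proof -
    have S: "coord j (z + \<delta> *\<^sub>R n) = coord j p + \<delta> / spacing D j" "dist (z + \<delta> *\<^sub>R n) p < \<epsilon>"
      using side[OF that(1,2)] by auto
    have "coord j (z + \<delta> *\<^sub>R n) \<notin> \<int>"
      using near[OF S(2) j] S(1) that(3) s by auto
    moreover have "coord i (z + \<delta> *\<^sub>R n) \<notin> \<int>" if "i < num_grids D" "i \<noteq> j" for i
      using near[OF S(2) that(1)] ip[OF that] by metis
    ultimately have "z + \<delta> *\<^sub>R n \<in> off_grid"
      unfolding off_grid_def by blast
    moreover have "grid_index D i (z + \<delta> *\<^sub>R n) = grid_index D i p + (if i = j \<and> \<delta> > 0 then 1 else 0)"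
      if "i < num_grids D" for i
    proof (cases "i = j")
      case True
      then show ?thesis
        using near[OF S(2) j] S(1) jp s by (simp add: zero_less_divide_iff)
    next
      case False
      then show ?thesis
        using near[OF S(2) that] ip[OF that] by simp
    qed
    ultimately show ?thesis by blast
  qed
  have p_seg: "p \<in> closed_segment p q" by simp
  have X: "x \<in> off_grid" "\<And>i. i < num_grids D \<Longrightarrow> grid_index D i x = grid_index D i p"
    using up[OF p_seg, of "- \<epsilon> / 4"] \<epsilon> by (auto simp: x_def)
  have Y: "y \<in> off_grid" "\<And>i. i < num_grids D \<Longrightarrow> grid_index D i y = grid_index D i p + (if i = j then 1 else 0)"
    using up[OF p_seg, of "\<epsilon> / 4"] \<epsilon> by (auto simp: y_def)
  \<comment> \<open>The sign \<open>c\<close> selects the side from which the point of the grid line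
    is approached.\<close>
  have cl: "z \<in> closure A" if "\<And>\<delta>. 0 < \<delta> \<Longrightarrow> \<delta> < \<epsilon> / 2 \<Longrightarrow> z + (c * \<delta>) *\<^sub>R n \<in> A" "\<bar>c\<bar> = 1" for z A and c :: real
  proof -
    have "\<exists>w\<in>A. dist w z < e" if "e > 0" for e
    proof
      define \<delta> where "\<delta> = min (\<epsilon> / 4) (e / 2)"
      have "0 < \<delta>" "\<delta> < \<epsilon> / 2" "\<delta> < e" using \<epsilon> that by (auto simp: \<delta>_def)
      then show "z + (c * \<delta>) *\<^sub>R n \<in> A" "dist (z + (c * \<delta>) *\<^sub>R n) z < e"
        using \<open>\<And>\<delta>. 0 < \<delta> \<Longrightarrow> \<delta> < \<epsilon> / 2 \<Longrightarrow> z + (c * \<delta>) *\<^sub>R n \<in> A\<close> \<open>\<bar>c\<bar> = 1\<close> nn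
        by (auto simp: dist_norm abs_mult)
    qed
    then show ?thesis
      by (simp add: closure_approachable)
  qed
  have fr: "z \<in> frontier (cell_of x) \<inter> frontier (cell_of y) \<inter> grid_line D j k" if z: "z \<in> closed_segment p q" for z
  proof -
    have "z \<in> closure (cell_of x)"
      using up[OF z, of "- \<delta>" for \<delta>] X by (intro cl[of _ "- 1"]) (auto simp: cell_of_def)
    moreover have "z \<in> closure (cell_of y)"
      by (rule cl[of _ "1"]) (use up[OF z] Y in \<open>auto simp: cell_of_def\<close>)
    moreover have "z \<notin> cell_of w" for w
      using seg[OF z] jp j by (auto simp: cell_of_def off_grid_def)
    moreover have "z \<in> grid_line D j k"
      using seg[OF z] k j by (simp add: in_grid_line_iff)
    ultimately show ?thesis
      unfolding frontier_def using interior_subset by blast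
  qed
  have "adjacent_cells D (cell_of x) (cell_of y)"
    unfolding adjacent_cells_def
  proof (intro conjI exI)
    show "cell_of x \<in> grid_cells D" "cell_of y \<in> grid_cells D"
      using X Y by (auto simp: grid_cells_eq)
    have "x \<notin> cell_of y" using X(2)[OF j] Y(2)[OF j] j by (auto simp: cell_of_def)
    then show "cell_of x \<noteq> cell_of y" using cell_of_self[OF X(1)] by auto
    show "p \<noteq> q" using \<epsilon> nn by (auto simp: q_def)
    show "closed_segment p q \<subseteq> frontier (cell_of x) \<inter> frontier (cell_of y) \<inter> grid_line D j k"
      using fr by blast
  qed (rule j)
  then show ?thesis
    using that X Y vertex_cong[of x p] vertex_step[OF j, of y p] by blast
qed

text \<open>Two lines of different grids meet in at most one point. Countability lets paths avoid
  the crossings and gives every segment a point that is not a crossing.\<close>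

lemma countable_crossings:
  "countable {x. \<exists>i<num_grids D. \<exists>j<num_grids D. i \<noteq> j \<and> coord i x \<in> \<int> \<and> coord j x \<in> \<int>}" (is "countable ?X")
proof -
  have sub: "?X \<subseteq> (\<Union>i<num_grids D. \<Union>j\<in>{j. j < num_grids D \<and> j \<noteq> i}. \<Union>k::int. \<Union>l::int.
      {x. coord i x = of_int k \<and> coord j x = of_int l})"
  proof
    fix x assume "x \<in> ?X"
    then obtain i j k l where "i < num_grids D" "j < num_grids D" "i \<noteq> j"
      "coord i x = of_int k" "coord j x = of_int l"
      by (auto elim!: Ints_cases)
    then show "x \<in> (\<Union>i<num_grids D. \<Union>j\<in>{j. j < num_grids D \<and> j \<noteq> i}. \<Union>k::int. \<Union>l::int.
      {x. coord i x = of_int k \<and> coord j x = of_int l})"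
      by (intro UN_I[of i] UN_I[of j] UN_I[of k] UN_I[of l]) auto
  qed
  have "countable {x. coord i x = of_int k \<and> coord j x = of_int l}"
    if "i < num_grids D" "j < num_grids D" "j \<noteq> i" for i j k l
  proof -
    have "{x. coord i x = of_int k \<and> coord j x = of_int l} \<subseteq> {y}" if "y \<in> {x. coord i x = of_int k \<and> coord j x = of_int l}" for y
      using that coord_eq_imp_eq[of i j _ y] \<open>i < num_grids D\<close> \<open>j < num_grids D\<close> \<open>j \<noteq> i\<close> by auto
    then have "{x. coord i x = of_int k \<and> coord j x = of_int l} = {} \<or>
        (\<exists>y. {x. coord i x = of_int k \<and> coord j x = of_int l} \<subseteq> {y})"
      by blast
    then show ?thesis
    proof (elim disjE exE)
      fix y assume "{x. coord i x = of_int k \<and> coord j x = of_int l} \<subseteq> {y}"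
      then show ?thesis by (rule countable_subset) simp
    qed (metis countable_empty)
  qed
  then show ?thesis
    by (intro countable_subset[OF sub] countable_UN) auto
qed

text \<open>A boundary segment is uncountable, so it has a point \<open>z\<close> on only one line.
  A cell touching \<open>z\<close> has one of just two index vectors, which differ by one in the
  \<open>j\<close>-th entry, and distinct cells have distinct index vectors.\<close>

lemma adjacent_cells_imp:
  assumes adj: "adjacent_cells D C C'"
  shows "\<exists>j p. only_on_grid j p \<and>
    {cell_vertex D len C, cell_vertex D len C'} = {vertex p, vertex p + edge_vec j}"
proof -
  obtain j k p q where j: "j < num_grids D" and "p \<noteq> q" and ne: "C \<noteq> C'"
    and seg: "closed_segment p q \<subseteq> frontier C \<inter> frontier C' \<inter> grid_line D j k"
    and C: "C \<in> grid_cells D" "C' \<in> grid_cells D"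
    using adj by (auto simp: adjacent_cells_def)
  have "uncountable (closed_segment p q)"
    using \<open>p \<noteq> q\<close> by (rule uncountable_closed_segment)
  then have "\<not> closed_segment p q \<subseteq> {x. \<exists>i<num_grids D. \<exists>j<num_grids D. i \<noteq> j \<and> coord i x \<in> \<int> \<and> coord j x \<in> \<int>}"
    using countable_subset countable_crossings by blast
  then obtain z where z: "z \<in> closed_segment p q"
    "\<not> (\<exists>i<num_grids D. \<exists>j<num_grids D. i \<noteq> j \<and> coord i z \<in> \<int> \<and> coord j z \<in> \<int>)"
    by blast
  have jz: "coord j z = of_int k"
    using z(1) seg j by (auto simp: in_grid_line_iff[OF j])
  then have on: "only_on_grid j z"
    using z(2) j by (auto simp: only_on_grid_def) (metis Ints_of_int jz)
  obtain x x' where x: "x \<in> off_grid" "x' \<in> off_grid" "C = cell_of x" "C' = cell_of x'"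
    using C by (auto simp: grid_cells_eq)
  have ind: "(\<forall>i<num_grids D. i \<noteq> j \<longrightarrow> grid_index D i w = grid_index D i z) \<and>
      (grid_index D j w = grid_index D j z \<or> grid_index D j w = grid_index D j z + 1)"
    if "z \<in> frontier (cell_of w)" for w
  proof -
    have "z \<in> closure (cell_of w)" using that by (simp add: frontier_def)
    from closure_eventually[OF this eventually_near] obtain y where y: "y \<in> cell_of w"
      and Y: "\<And>i. i < num_grids D \<Longrightarrow>
        grid_index D i y = grid_index D i z + (if coord i z \<in> \<int> \<and> coord i y > coord i z then 1 else 0)"
      by blast
    have "grid_index D i w = grid_index D i y" if "i < num_grids D" for i
      using y that by (auto simp: cell_of_def)
    then show ?thesis
      using Y on j by (auto simp: only_on_grid_def)
  qed
  have zf: "z \<in> frontier (cell_of x)" "z \<in> frontier (cell_of x')"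
    using z(1) seg x by auto
  have vx: "vertex w = (if grid_index D j w = grid_index D j z then vertex z else vertex z + edge_vec j)"
    if "z \<in> frontier (cell_of w)" for w
  proof (cases "grid_index D j w = grid_index D j z")
    case True
    then show ?thesis
      using ind[OF that] vertex_cong[of w z] by auto
  next
    case False
    then show ?thesis
      using ind[OF that] vertex_step[OF j, of w z] by auto
  qed
  have "grid_index D j x \<noteq> grid_index D j x'"
  proof
    assume "grid_index D j x = grid_index D j x'"
    then have "grid_index D i x = grid_index D i x'" if "i < num_grids D" for i
      using ind[OF zf(1)] ind[OF zf(2)] that by metis
    then have "cell_of x = cell_of x'" by (auto simp: cell_of_def)
    then show False using ne x by simp
  qed
  then have "{vertex x, vertex x'} = {vertex z, vertex z + edge_vec j}"
    using vx[OF zf(1)] vx[OF zf(2)] ind[OF zf(1)] ind[OF zf(2)] by auto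
  then show ?thesis
    using on x by (auto simp: cell_vertex_cell_of)
qed

section \<open>Joints, bars, the flex condition and labels\<close>

definition joint_set :: "(real^2) set" where "joint_set = vertex ` off_grid"

lemma joints_parallelogram_framework: "joints (parallelogram_framework D len) = joint_set"
  by (simp add: joints_def parallelogram_framework_def grid_cells_eq joint_set_def image_image cell_vertex_cell_of)

lemma verts_parallelogram_framework: "verts (parallelogram_framework D len) = joint_set"
  using joints_parallelogram_framework by (simp add: joints_def parallelogram_framework_def)

lemma place_parallelogram_framework: "place (parallelogram_framework D len) = id"
  by (simp add: parallelogram_framework_def)

lemma edges_parallelogram_framework:
  "edges (parallelogram_framework D len) = {{vertex p, vertex p + edge_vec j} | j p. only_on_grid j p}"
  (is "?L = ?R")
proof
  show "?L \<subseteq> ?R"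
  proof
    fix e assume "e \<in> ?L"
    then obtain C C' where "adjacent_cells D C C'" "e = {cell_vertex D len C, cell_vertex D len C'}"
      by (auto simp: parallelogram_framework_def)
    then show "e \<in> ?R"
      using adjacent_cells_imp[of C C'] by blast
  qed
  show "?R \<subseteq> ?L"
  proof
    fix e assume "e \<in> ?R"
    then obtain j p where p: "only_on_grid j p" "e = {vertex p, vertex p + edge_vec j}" by auto
    from p(1) obtain x y where "x \<in> off_grid" "y \<in> off_grid" "adjacent_cells D (cell_of x) (cell_of y)"
      "vertex x = vertex p" "vertex y = vertex p + edge_vec j"
      by (rule only_on_grid_neighbours) blast
    then have "adjacent_cells D (cell_of x) (cell_of y) \<and>
        e = {cell_vertex D len (cell_of x), cell_vertex D len (cell_of y)}"
      using p(2) by (simp add: cell_vertex_cell_of)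
    then show "e \<in> ?L"
      by (auto simp: parallelogram_framework_def)
  qed
qed

lemma bars_parallelogram_framework:
  "bars (parallelogram_framework D len) = {{vertex p, vertex p + edge_vec j} | j p. only_on_grid j p}"
  by (simp add: bars_def place_parallelogram_framework edges_parallelogram_framework)

lemma only_on_grid_joint_set:
  assumes "only_on_grid j p"
  shows "vertex p \<in> joint_set" "vertex p + edge_vec j \<in> joint_set"
proof -
  from assms obtain x y where "x \<in> off_grid" "y \<in> off_grid"
    "vertex x = vertex p" "vertex y = vertex p + edge_vec j"
    by (rule only_on_grid_neighbours) blast
  then show "vertex p \<in> joint_set" "vertex p + edge_vec j \<in> joint_set"
    unfolding joint_set_def by (metis imageI)+
qed

lemma infinitesimal_flex_iff:
  "infinitesimal_flex (parallelogram_framework D len) u \<longleftrightarrow>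
    (\<forall>j p. only_on_grid j p \<longrightarrow> pairing (u (vertex p + edge_vec j) - u (vertex p)) (edge_vec j) = 0)"
proof -
  \<comment> \<open>Reversing a bar changes the sign of both factors, so its orientation is
    immaterial.\<close>
  have neg: "pairing (a - b) (- x) = pairing (b - a) x" for a b x
    by (simp add: pairing_diff pairing_minus_right)
  show ?thesis
    unfolding infinitesimal_flex_def edges_parallelogram_framework place_parallelogram_framework id_apply
  proof (intro iffI allI impI)
    fix j p
    assume "\<forall>v w. {v, w} \<in> {{vertex p, vertex p + edge_vec j} |j p. only_on_grid j p} \<longrightarrow>
              pairing (u v - u w) (v - w) = 0" "only_on_grid j p"
    then have "pairing (u (vertex p) - u (vertex p + edge_vec j)) (vertex p - (vertex p + edge_vec j)) = 0"
      by blast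
    then show "pairing (u (vertex p + edge_vec j) - u (vertex p)) (edge_vec j) = 0"
      by (simp add: neg)
  next
    fix v w
    assume *: "\<forall>j p. only_on_grid j p \<longrightarrow> pairing (u (vertex p + edge_vec j) - u (vertex p)) (edge_vec j) = 0"
      and "{v, w} \<in> {{vertex p, vertex p + edge_vec j} |j p. only_on_grid j p}"
    then obtain j p where jp: "only_on_grid j p" "{v, w} = {vertex p, vertex p + edge_vec j}" by blast
    then consider "v = vertex p" "w = vertex p + edge_vec j" | "w = vertex p" "v = vertex p + edge_vec j"
      by (auto simp: doubleton_eq_iff)
    then show "pairing (u v - u w) (v - w) = 0"
      using * jp(1) by cases (auto simp: neg)
  qed
qed

text \<open>A monotonicity argument: pair \<open>vertex x - vertex y\<close> with
  \<open>x - y\<close>. Each grid contributes a nonnegative term, because its index is nondecreasing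
  along its normal, and the term is positive if the indices differ.\<close>

lemma vertex_eq_imp_grid_index_eq:
  assumes "vertex x = vertex y" "j < num_grids D"
  shows "grid_index D j x = grid_index D j y"
proof -
  let ?t = "\<lambda>j. of_int (grid_index D j x - grid_index D j y) * (len j * ((x - y) \<bullet> normal D j))"
  have pos: "?t i \<ge> 0 \<and> (?t i = 0 \<longrightarrow> grid_index D i x = grid_index D i y)" if i: "i < num_grids D" for i
  proof -
    have s: "spacing D i > 0" and l: "len i > 0" using spacing_pos i len_pos by auto
    have d: "(x - y) \<bullet> normal D i = spacing D i * (coord i x - coord i y)"
      using s by (simp add: coord_def inner_diff_left field_simps)
    consider "grid_index D i x = grid_index D i y" | "grid_index D i x > grid_index D i y" | "grid_index D i x < grid_index D i y"
      by linarith
    then have "?t i > 0 \<or> grid_index D i x = grid_index D i y"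
    proof cases
      case 2
      then have "coord i x > coord i y" unfolding grid_index_eq_ceiling
        by (metis ceiling_mono not_less)
      then have "?t i > 0" unfolding d using 2 s l by (intro mult_pos_pos) auto
      then show ?thesis by simp
    next
      case 3
      then have "coord i x < coord i y" unfolding grid_index_eq_ceiling
        by (metis ceiling_mono not_less)
      then have "(x - y) \<bullet> normal D i < 0" unfolding d using s by (simp add: mult_pos_neg)
      then have "?t i > 0" using 3 l by (intro mult_neg_neg mult_pos_neg) auto
      then show ?thesis by simp
    qed auto
    then show ?thesis by (elim disjE) (linarith, simp)
  qed
  have "(\<Sum>i<num_grids D. ?t i) = (x - y) \<bullet> (vertex x - vertex y)"
    unfolding vertex_def edge_vec_def sum_subtractf[symmetric] inner_sum_right
    by (rule sum.cong) (simp_all add: inner_diff_right algebra_simps)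
  then have "(\<Sum>i<num_grids D. ?t i) = 0"
    using assms by simp
  then have "?t j = 0"
    using sum_nonneg_0[of "{..<num_grids D}" ?t j] pos assms(2) by blast
  then show ?thesis using pos[OF assms(2)] by blast
qed

text \<open>The grid index as a function of the joint. The choice of \<open>x\<close> is harmless by
  \<open>vertex_eq_imp_grid_index_eq\<close>.\<close>

definition label :: "nat \<Rightarrow> real^2 \<Rightarrow> int" where
  "label j v = grid_index D j (SOME x. vertex x = v)"

lemma label_vertex [simp]: "j < num_grids D \<Longrightarrow> label j (vertex x) = grid_index D j x"
  unfolding label_def by (rule vertex_eq_imp_grid_index_eq) (rule someI[of _ x], simp)

lemma label_edge:
  assumes "only_on_grid j p" "i < num_grids D"
  shows "label i (vertex p + edge_vec j) = label i (vertex p) + (if i = j then 1 else 0)"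
proof -
  from assms(1) obtain x y where "vertex y = vertex p + edge_vec j" "vertex x = vertex p"
    "\<And>i. i < num_grids D \<Longrightarrow> grid_index D i y = grid_index D i p + (if i = j then 1 else 0)"
    by (rule only_on_grid_neighbours) blast
  then show ?thesis
    using assms(2) label_vertex[of i y] by simp
qed

text \<open>The plane without the countably many crossings is connected, and a path in it crosses
  one line at a time, so that \<open>vertex\<close> changes by one edge at each crossing.\<close>

lemma edge_invariant_imp_constant:
  assumes g: "\<And>j p. only_on_grid j p \<Longrightarrow> g (vertex p + edge_vec j) = g (vertex p)"
    and "v \<in> joint_set" "w \<in> joint_set"
  shows "g v = g w"
proof -
  let ?W = "- {x. \<exists>i<num_grids D. \<exists>j<num_grids D. i \<noteq> j \<and> coord i x \<in> \<int> \<and> coord j x \<in> \<int>}"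
  have conn: "connected ?W"
    by (intro path_connected_imp_connected path_connected_complement_countable countable_crossings) simp
  obtain x y where xy: "x \<in> off_grid" "y \<in> off_grid" "v = vertex x" "w = vertex y"
    using assms(2,3) by (auto simp: joint_set_def)
  have "g (vertex x) = g (vertex y)"
  proof (rule locally_constant_imp_eq[OF conn, of "\<lambda>x. g (vertex x)"])
    show "x \<in> ?W" "y \<in> ?W" using xy by (auto simp: off_grid_def)
    fix z assume z: "z \<in> ?W"
    show "eventually (\<lambda>y. y \<in> ?W \<longrightarrow> g (vertex y) = g (vertex z)) (nhds z)"
      using eventually_near[of z]
    proof (rule eventually_mono, intro impI)
      fix y
      assume near: "\<forall>j<num_grids D. grid_index D j y =
            grid_index D j z + (if coord j z \<in> \<int> \<and> coord j z < coord j y then 1 else 0) \<and>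
            (coord j y \<in> \<int> \<longrightarrow> coord j y = coord j z)"
      show "g (vertex y) = g (vertex z)"
      proof (cases "\<exists>j<num_grids D. coord j z \<in> \<int> \<and> coord j z < coord j y")
        case False
        then show ?thesis using near vertex_cong[of y z] by auto
      next
        case True
        then obtain j where j: "j < num_grids D" "coord j z \<in> \<int>" "coord j z < coord j y" by blast
        then have on: "only_on_grid j z" using z by (auto simp: only_on_grid_def)
        then have "vertex y = vertex z + edge_vec j"
          using near j by (intro vertex_step) (auto simp: only_on_grid_def)
        then show ?thesis using g[OF on] by simp
      qed
    qed
  qed
  then show ?thesis using xy by simp
qed

subsection \<open>Flexes and ribbons\<close>

text \<open>These are the two edges of direction \<open>j\<close> of the tile dual to the crossing
  \<open>z\<close>. They are found by leaving \<open>z\<close> along its line of the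
  \<open>j\<close>-th grid, to either side of the line of the \<open>i\<close>-th grid.\<close>

lemma crossing_edges:
  assumes ij: "i < num_grids D" "j < num_grids D" "i \<noteq> j" and z: "coord i z \<in> \<int>" "coord j z \<in> \<int>"
  obtains p p' where "only_on_grid j p" "vertex p = vertex z"
    "only_on_grid j p'" "vertex p' = vertex z + edge_vec i"
proof -
  obtain \<epsilon> where \<epsilon>: "\<epsilon> > 0" and near: "\<And>y i. dist y z < \<epsilon> \<Longrightarrow> i < num_grids D \<Longrightarrow>
      grid_index D i y = grid_index D i z + (if coord i z \<in> \<int> \<and> coord i y > coord i z then 1 else 0) \<and>
      (coord i y \<in> \<int> \<longrightarrow> coord i y = coord i z)"
    using eventually_near[of z] unfolding eventually_nhds_metric by blast
  define t where "t = perp (normal D j)"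
  define c where "c = t \<bullet> normal D i / spacing D i"
  have c: "c \<noteq> 0"
    using cross2_normal[of j i] ij spacing_pos[of i] by (simp add: c_def t_def perp_inner_cross2)
  have nt: "norm t = 1"
    using norm_normal[OF ij(2)] by (simp add: t_def norm_eq_1 inner2 algebra_simps)
  have step: "only_on_grid j (z + \<delta> *\<^sub>R t) \<and>
      vertex (z + \<delta> *\<^sub>R t) = (if \<delta> * c > 0 then vertex z + edge_vec i else vertex z)"
    if \<delta>: "\<delta> \<noteq> 0" "\<bar>\<delta>\<bar> < \<epsilon>" for \<delta>
  proof -
    let ?y = "z + \<delta> *\<^sub>R t"
    have d: "dist ?y z < \<epsilon>"
      using \<delta> nt by (simp add: dist_norm)
    have cj: "coord j ?y = coord j z"
      by (simp add: coord_add t_def)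
    have ci: "coord i ?y = coord i z + \<delta> * c"
      by (simp add: coord_add c_def)
    have ni: "coord i ?y \<notin> \<int>"
      using near[OF d ij(1)] ci c \<delta>(1) by auto
    have nl: "coord l z \<notin> \<int>" if "l < num_grids D" "l \<noteq> i" "l \<noteq> j" for l
      using at_most_two_grids[of i j l z] ij z that by blast
    have nl': "coord l ?y \<notin> \<int>" if "l < num_grids D" "l \<noteq> i" "l \<noteq> j" for l
      using near[OF d that(1)] nl[OF that] by metis
    have on: "only_on_grid j ?y"
      using ij cj z ni nl' by (auto simp: only_on_grid_def)
    have idx: "grid_index D l ?y = grid_index D l z + (if l = i \<and> \<delta> * c > 0 then 1 else 0)" if l: "l < num_grids D" for l
    proof -
      consider "l = i" | "l = j" | "l \<noteq> i" "l \<noteq> j" by blast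
      then show ?thesis
      proof cases
        case 1
        then show ?thesis using near[OF d l] ci z(1) by auto
      next
        case 2
        then show ?thesis using near[OF d l] cj ij by auto
      next
        case 3
        then show ?thesis using near[OF d l] nl[OF l] by auto
      qed
    qed
    show ?thesis
      using on idx vertex_cong[of ?y z] vertex_step[OF ij(1), of ?y z] by auto
  qed
  \<comment> \<open>With this sign \<open>\<delta>\<close> leads beyond the line of the
    \<open>i\<close>-th grid, where the index has jumped, and \<open>- \<delta>\<close> stays before
    it.\<close>
  define \<delta> where "\<delta> = \<epsilon> / 2 * sgn c"
  have "\<bar>\<delta>\<bar> < \<epsilon>" "\<delta> \<noteq> 0" "\<delta> * c > 0"
    using \<epsilon> c by (auto simp: \<delta>_def abs_mult sgn_if mult_less_0_iff)
  then show ?thesis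
    using step[of \<delta>] step[of "- \<delta>"] by (intro that[of "z + (- \<delta>) *\<^sub>R t" "z + \<delta> *\<^sub>R t"]) auto
qed

text \<open>In a parallelogram, opposite edges have equal velocity differences: their discrepancy is
  orthogonal to both edge directions. Hence the difference is constant along a grid line.\<close>

lemma flex_difference_constant_on_ribbon:
  assumes flex: "infinitesimal_flex (parallelogram_framework D len) u"
    and p: "only_on_grid j p" and q: "only_on_grid j q"
    and eq: "grid_index D j p = grid_index D j q"
  shows "u (vertex p + edge_vec j) - u (vertex p) = u (vertex q + edge_vec j) - u (vertex q)"
proof -
  let ?S = "{x. coord j x = coord j p}"
  let ?f = "\<lambda>x. u (vertex x + edge_vec j) - u (vertex x)"
  have j: "j < num_grids D" and jp: "coord j p \<in> \<int>" and jq: "coord j q \<in> \<int>"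
    using p q by (auto simp: only_on_grid_def)
  have fl: "pairing (u (vertex p + edge_vec j) - u (vertex p)) (edge_vec j) = 0" if "only_on_grid j p" for j p
    using flex that unfolding infinitesimal_flex_iff by blast
  have S: "?S = {x. normal D j \<bullet> x = p \<bullet> normal D j}"
    using spacing_pos[OF j] by (auto simp: coord_def inner_commute)
  have conn: "connected ?S"
    unfolding S by (intro convex_connected convex_hyperplane)
  \<comment> \<open>The ceiling is exact at integers, so equal indices put \<open>p\<close> and
    \<open>q\<close> on the same line.\<close>
  have qS: "q \<in> ?S"
    using eq jp jq by (auto simp: grid_index_eq_ceiling elim!: Ints_cases)
  have pS: "p \<in> ?S" by simp
  show ?thesis
  proof (rule locally_constant_imp_eq[OF conn _ pS qS, of ?f])
    fix z assume z: "z \<in> ?S"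
    then have jz: "coord j z \<in> \<int>" using jp by simp
    show "eventually (\<lambda>y. y \<in> ?S \<longrightarrow> ?f y = ?f z) (nhds z)"
      using eventually_near[of z]
    proof (rule eventually_mono, intro impI)
      fix y
      assume near: "\<forall>j<num_grids D. grid_index D j y =
            grid_index D j z + (if coord j z \<in> \<int> \<and> coord j z < coord j y then 1 else 0) \<and>
            (coord j y \<in> \<int> \<longrightarrow> coord j y = coord j z)" and y: "y \<in> ?S"
      show "?f y = ?f z"
      proof (cases "\<exists>i<num_grids D. coord i z \<in> \<int> \<and> coord i z < coord i y")
        case False
        then have "vertex y = vertex z" using near by (intro vertex_cong) auto
        then show ?thesis by simp
      next
        case True
        then obtain i where i: "i < num_grids D" "coord i z \<in> \<int>" "coord i z < coord i y" by blast
        \<comment> \<open>The points \<open>y\<close> and \<open>z\<close> share their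
          \<open>j\<close>-th coordinate, so the index that jumps belongs to another grid.\<close>
        then have ne: "i \<noteq> j" using y z by auto
        have vy: "vertex y = vertex z + edge_vec i"
        proof (rule vertex_step[OF i(1)])
          fix l assume l: "l < num_grids D"
          show "grid_index D l y = grid_index D l z + (if l = i then 1 else 0)"
          proof (cases "l = i \<or> l = j")
            case True
            then show ?thesis using near l i y z ne by auto
          next
            case False
            then have "coord l z \<notin> \<int>" using at_most_two_grids[of i j l z] i j jz ne l by auto
            then show ?thesis using near l False by auto
          qed
        qed
        obtain p1 p2 where P: "only_on_grid j p1" "vertex p1 = vertex z"
          "only_on_grid j p2" "vertex p2 = vertex z + edge_vec i"
          using crossing_edges[OF i(1) j ne i(2) jz] by blast
        obtain q1 q2 where Q: "only_on_grid i q1" "vertex q1 = vertex z"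
          "only_on_grid i q2" "vertex q2 = vertex z + edge_vec j"
          using crossing_edges[OF j i(1) ne[symmetric] jz i(2)] by blast
        let ?V = "vertex z"
        have e: "?V + edge_vec j + edge_vec i = ?V + edge_vec i + edge_vec j" by simp
        let ?Z = "(u (?V + edge_vec i + edge_vec j) - u (?V + edge_vec i)) - (u (?V + edge_vec j) - u ?V)"
        have "pairing ?Z (edge_vec j) = 0"
          using fl[OF P(1)] fl[OF P(3)] unfolding P(2,4) by (simp add: pairing_diff)
        moreover have "pairing ?Z (edge_vec i) = 0"
          using fl[OF Q(1)] fl[OF Q(3)] unfolding Q(2,4) e by (simp add: pairing_diff)
        ultimately have "?Z = 0"
          using pairing_eq_0_imp[OF cross2_edge_vec[OF j i(1) ne[symmetric]]] by blast
        then show ?thesis using vy by simp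
      qed
    qed
  qed
qed

text \<open>An edge of another direction leaves the \<open>j\<close>-th label unchanged, and an edge
  of direction \<open>j\<close> is orthogonal to the velocities.\<close>

lemma infinitesimal_flex_of_label:
  assumes "j < num_grids D"
    and u: "\<And>v. v \<in> joint_set \<Longrightarrow> u v = F (label j v) *s constant_field (perp (normal D j)) v"
  shows "infinitesimal_flex (parallelogram_framework D len) u"
  unfolding infinitesimal_flex_iff
proof (intro allI impI)
  fix i p assume p: "only_on_grid i p"
  have "constant_field (perp (normal D j)) v = constant_field (perp (normal D j)) w" for v w
    by (simp add: constant_field_def)
  then have eq: "u (vertex p + edge_vec i) - u (vertex p) =
      (F (label j (vertex p + edge_vec i)) - F (label j (vertex p))) *s constant_field (perp (normal D j)) (vertex p)"
    using u only_on_grid_joint_set[OF p] by (simp add: vector_sub_rdistrib)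
  show "pairing (u (vertex p + edge_vec i) - u (vertex p)) (edge_vec i) = 0"
    unfolding eq pairing_smult pairing_constant_field
    using label_edge[OF p assms(1)] by (cases "i = j") (simp_all add: edge_vec_def)
qed

subsection \<open>Local finiteness\<close>

text \<open>Up to a bounded error, \<open>vertex\<close> is a positive definite linear map.\<close>

lemma finite_joint_set_ball: "finite {v \<in> joint_set. norm v \<le> R}"
proof -
  let ?n = "num_grids D"
  define f where "f x = (\<Sum>j<?n. (x \<bullet> normal D j / spacing D j) *\<^sub>R edge_vec j)" for x :: "real^2"
  \<comment> \<open>Rounding moves an index by at most 1 and the shift by
    \<open>\<bar>shift D j\<bar> / spacing D j\<close>.\<close>
  define B where "B = (\<Sum>j<?n. (1 + \<bar>shift D j\<bar> / spacing D j) * norm (edge_vec j))"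
  have idx: "\<bar>of_int (grid_index D j x) - x \<bullet> normal D j / spacing D j\<bar> \<le> 1 + \<bar>shift D j\<bar> / spacing D j"
    if "j < ?n" for j x
  proof -
    have "\<bar>of_int (grid_index D j x) - coord j x\<bar> \<le> 1"
      unfolding grid_index_eq_ceiling by linarith
    moreover have "coord j x = x \<bullet> normal D j / spacing D j + shift D j / spacing D j"
      by (simp add: coord_def add_divide_distrib)
    moreover have "\<bar>shift D j / spacing D j\<bar> = \<bar>shift D j\<bar> / spacing D j"
      using spacing_pos[OF that] by simp
    ultimately show ?thesis by linarith
  qed
  have "linear f"
    unfolding f_def by (rule linearI) (simp_all add: inner_add_left add_divide_distrib scaleR_add_left
        sum.distrib scaleR_sum_right)
  moreover have "inj f"
  proof (rule linear_injective_0[OF \<open>linear f\<close>, THEN iffD2], intro allI impI)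
    fix x assume "f x = 0"
    then have "x \<bullet> f x = 0" by simp
    moreover have "x \<bullet> f x = (\<Sum>j<?n. len j / spacing D j * (x \<bullet> normal D j)\<^sup>2)"
      by (simp add: f_def inner_sum_right edge_vec_def power2_eq_square ac_simps)
    moreover have "0 \<le> len j / spacing D j * (x \<bullet> normal D j)\<^sup>2" if "j < ?n" for j
      using len_pos[OF that] spacing_pos[OF that] by simp
    ultimately have "len j / spacing D j * (x \<bullet> normal D j)\<^sup>2 = 0" if "j < ?n" for j
      using sum_nonneg_0[of "{..<?n}" "\<lambda>j. len j / spacing D j * (x \<bullet> normal D j)\<^sup>2" j] that by simp
    then have "x \<bullet> normal D j = 0" if "j < ?n" for j
      using len_pos[OF that] spacing_pos[OF that] that by fastforce
    then have "coord j x = coord j 0" if "j < ?n" for j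
      using that by (simp add: coord_def)
    then show "x = 0"
      using coord_eq_imp_eq[of 0 1 x 0] two_le_num_grids by simp
  qed
  ultimately obtain b where b: "b > 0" "\<And>x. b * norm x \<le> norm (f x)"
    using linear_inj_bounded_below_pos by blast
  have close: "norm (vertex x - f x) \<le> B" for x
  proof -
    have "vertex x - f x = (\<Sum>j<?n. (of_int (grid_index D j x) - x \<bullet> normal D j / spacing D j) *\<^sub>R edge_vec j)"
      by (simp add: vertex_def f_def sum_subtractf scaleR_diff_left)
    also have "norm \<dots> \<le> B"
      unfolding B_def by (rule sum_norm_le) (auto intro!: mult_right_mono idx)
    finally show ?thesis .
  qed
  \<comment> \<open>A joint of norm at most \<open>R\<close> comes from points of norm at most
    \<open>r\<close>, which confines its indices to a finite box.\<close>
  define r where "r = (R + B) / b"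
  define I where "I j = nat \<lceil>r / spacing D j + 1 + \<bar>shift D j\<bar> / spacing D j\<rceil>" for j
  have bound: "\<bar>grid_index D j x\<bar> \<le> int (I j)" if "norm (vertex x) \<le> R" "j < ?n" for x j
  proof -
    have "norm (f x) \<le> norm (vertex x) + norm (vertex x - f x)"
      using norm_triangle_ineq4[of "vertex x" "vertex x - f x"] by simp
    then have "b * norm x \<le> R + B"
      using b(2)[of x] close[of x] that(1) by linarith
    then have nx: "norm x \<le> r"
      using b(1) by (simp add: r_def pos_le_divide_eq mult.commute)
    have "\<bar>x \<bullet> normal D j\<bar> \<le> norm x"
      using Cauchy_Schwarz_ineq2[of x "normal D j"] norm_normal[OF that(2)] by simp
    then have "\<bar>x \<bullet> normal D j / spacing D j\<bar> \<le> r / spacing D j"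
      using nx spacing_pos[OF that(2)] by (simp add: divide_right_mono)
    then have "\<bar>of_int (grid_index D j x)\<bar> \<le> r / spacing D j + 1 + \<bar>shift D j\<bar> / spacing D j"
      using idx[OF that(2), of x] by linarith
    then show ?thesis
      unfolding I_def by linarith
  qed
  let ?P = "PiE {..<?n} (\<lambda>j. {- int (I j)..int (I j)})"
  have "{v \<in> joint_set. norm v \<le> R} \<subseteq> (\<lambda>k. \<Sum>j<?n. of_int (k j) *\<^sub>R edge_vec j) ` ?P"
  proof
    fix v assume "v \<in> {v \<in> joint_set. norm v \<le> R}"
    then obtain x where x: "v = vertex x" "norm (vertex x) \<le> R" by (auto simp: joint_set_def)
    let ?k = "restrict (\<lambda>j. grid_index D j x) {..<?n}"
    have "?k \<in> ?P"
    proof (rule restrict_PiE_iff[THEN iffD2], intro ballI)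
      fix j assume "j \<in> {..<?n}"
      then have "\<bar>grid_index D j x\<bar> \<le> int (I j)" using bound[OF x(2)] by simp
      then show "grid_index D j x \<in> {- int (I j)..int (I j)}" by (simp add: abs_le_iff)
    qed
    moreover have "v = (\<Sum>j<?n. of_int (?k j) *\<^sub>R edge_vec j)"
      unfolding x(1) vertex_def by (rule sum.cong) auto
    ultimately show "v \<in> (\<lambda>k. \<Sum>j<?n. of_int (k j) *\<^sub>R edge_vec j) ` ?P" by blast
  qed
  moreover have "finite ?P" by (intro finite_PiE) auto
  ultimately show ?thesis
    using finite_subset by blast
qed

text \<open>The grid lines form a null set, so every open half-plane contains points off the
  grid.\<close>

lemma label_unbounded:
  assumes j: "j < num_grids D"
  shows "\<exists>v\<in>joint_set. label j v > N"
proof -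
  have "grid_lines D = (\<lambda>(j, k). grid_line D j k) ` ({..<num_grids D} \<times> UNIV)"
    by (auto simp: grid_lines_def)
  then have "countable (grid_lines D)" by simp
  moreover have "negligible L" if L: "L \<in> grid_lines D" for L
  proof -
    obtain j k where j: "j < num_grids D" "L = grid_line D j k"
      using L by (auto simp: grid_lines_def)
    have "L = {x. normal D j \<bullet> x = of_int k * spacing D j - shift D j}"
      unfolding j(2) grid_line_def by (auto simp: inner_commute algebra_simps)
    then show ?thesis
      using normal_nonzero[OF j(1)] by (simp add: negligible_hyperplane)
  qed
  ultimately have "negligible (\<Union> (grid_lines D))"
    by (rule negligible_countable_Union)
  moreover have "open (coord j -` {of_int N<..})"
    by (rule open_vimage) (auto intro: continuous_coord)
  moreover have "coord j -` {of_int N<..} \<noteq> {}"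
  proof -
    let ?x = "(spacing D j * (of_int N + 1) - shift D j) *\<^sub>R normal D j"
    have "coord j ?x = of_int N + 1"
      using spacing_pos[OF j] norm_normal[OF j] by (simp add: coord_def dot_square_norm)
    then have "?x \<in> coord j -` {of_int N<..}" by simp
    then show ?thesis by blast
  qed
  ultimately have "\<not> coord j -` {of_int N<..} \<subseteq> \<Union> (grid_lines D)"
    using open_not_negligible negligible_subset by blast
  then obtain x where "x \<in> off_grid" "coord j x > of_int N"
    unfolding off_grid_eq[symmetric] by blast
  then have "vertex x \<in> joint_set" "label j (vertex x) > N"
    using j by (auto simp: joint_set_def grid_index_eq_ceiling less_ceiling_iff)
  then show ?thesis by blast
qed

subsection \<open>Translations\<close>

definition bar_set :: "(real^2) set set" where
  "bar_set = {{vertex p, vertex p + edge_vec j} | j p. only_on_grid j p}"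

definition translation :: "real^2 \<Rightarrow> bool" where
  "translation a \<longleftrightarrow> (+) a ` joint_set = joint_set \<and> (`) ((+) a) ` bar_set = bar_set"

lemma translation_add:
  assumes "translation a" "translation b"
  shows "translation (a + b)"
proof -
  have 1: "(+) (a + b) ` X = (+) a ` ((+) b ` X)" for X
    by (simp add: image_image add.assoc)
  have 2: "(`) ((+) (a + b)) ` X = (`) ((+) a) ` ((`) ((+) b) ` X)" for X
    by (simp add: image_image add.assoc)
  show ?thesis
    using assms unfolding translation_def 1 2 by simp
qed

lemma translation_minus:
  assumes "translation a"
  shows "translation (- a)"
proof -
  have 1: "(+) (- a) ` ((+) a ` X) = X" for X
    by (simp add: image_image)
  have 2: "(`) ((+) (- a)) ` ((`) ((+) a) ` X) = X" for X
    by (simp add: image_image)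
  show ?thesis
    using assms 1[of joint_set] 2[of bar_set] unfolding translation_def by simp
qed

lemma translation_joint: "translation a \<Longrightarrow> v \<in> joint_set \<Longrightarrow> a + v \<in> joint_set"
  unfolding translation_def by blast

text \<open>Edge directions of different grids are not parallel, so the translated bar belongs to
  the same grid. Its orientation is kept too, since otherwise \<open>edge_vec j\<close> would equal
  its own negative.\<close>

lemma translation_edge:
  assumes a: "translation a" and p: "only_on_grid j p"
  shows "\<exists>q. only_on_grid j q \<and> vertex q = a + vertex p"
proof -
  have "{vertex p, vertex p + edge_vec j} \<in> bar_set"
    using p by (auto simp: bar_set_def)
  then have "(+) a ` {vertex p, vertex p + edge_vec j} \<in> bar_set"
    using a unfolding translation_def by blast
  then obtain i q where q: "only_on_grid i q"
    and eq: "{a + vertex p, a + (vertex p + edge_vec j)} = {vertex q, vertex q + edge_vec i}"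
    by (auto simp: bar_set_def)
  have ij: "i < num_grids D" "j < num_grids D" using p q by (auto simp: only_on_grid_def)
  from eq consider "a + vertex p = vertex q" "a + (vertex p + edge_vec j) = vertex q + edge_vec i"
    | "a + vertex p = vertex q + edge_vec i" "a + (vertex p + edge_vec j) = vertex q"
    by (auto simp: doubleton_eq_iff)
  then show ?thesis
  proof cases
    case 1
    then have "edge_vec i = edge_vec j" by (simp add: add.assoc[symmetric])
    then have "cross2 (edge_vec i) (edge_vec j) = 0" by simp
    then have "i = j" using cross2_edge_vec ij by blast
    then show ?thesis using 1 q by auto
  next
    case 2
    then have "vertex q + edge_vec i + edge_vec j = vertex q"
      by (metis add.assoc)
    then have e: "edge_vec j = - edge_vec i"
      by (simp add: add.assoc add_eq_0_iff)
    then have "cross2 (edge_vec i) (edge_vec j) = 0" by (simp add: cross2_def)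
    then have "i = j" using cross2_edge_vec ij by blast
    then have "edge_vec j = 0" using e by (simp add: vec_eq_iff)
    then show ?thesis using edge_vec_nonzero ij by blast
  qed
qed

lemma joint_set_nonempty: "joint_set \<noteq> {}"
  using label_unbounded[of 0] two_le_num_grids by auto

text \<open>A translation carries edges of each direction to edges of that direction, so the label
  and its translate change together along every edge.\<close>

lemma translation_label:
  assumes "translation a" "i < num_grids D" "v \<in> joint_set" "w \<in> joint_set"
  shows "label i (a + v) - label i v = label i (a + w) - label i w"
proof (rule edge_invariant_imp_constant[of "\<lambda>v. label i (a + v) - label i v", OF _ assms(3,4)])
  fix j p assume p: "only_on_grid j p"
  obtain q where q: "only_on_grid j q" "vertex q = a + vertex p"
    using translation_edge[OF assms(1) p] by blast
  have "label i (a + (vertex p + edge_vec j)) = label i (vertex q + edge_vec j)"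
    by (simp add: q(2) add.assoc)
  then show "label i (a + (vertex p + edge_vec j)) - label i (vertex p + edge_vec j) =
      label i (a + vertex p) - label i (vertex p)"
    using label_edge[OF p assms(2)] label_edge[OF q(1) assms(2)] q(2) by simp
qed

text \<open>A relation between a translation and its shifts, so that shifts of sums and multiples
  arise by combining witnesses.\<close>

definition shifts_labels :: "real^2 \<Rightarrow> (nat \<Rightarrow> int) \<Rightarrow> bool" where
  "shifts_labels a d \<longleftrightarrow> translation a \<and>
    (\<forall>v\<in>joint_set. \<forall>j<num_grids D. label j (a + v) = label j v + d j)"

lemma shifts_labels_exists:
  assumes "translation a"
  shows "\<exists>d. shifts_labels a d"
proof -
  obtain w where "w \<in> joint_set" using joint_set_nonempty by blast
  then have "label j (a + v) = label j v + (label j (a + w) - label j w)"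
    if "v \<in> joint_set" "j < num_grids D" for j v
    using translation_label[OF assms that(2,1)] by (simp add: algebra_simps)
  then show ?thesis
    using assms unfolding shifts_labels_def by (intro exI[of _ "\<lambda>j. label j (a + w) - label j w"]) blast
qed

lemma shifts_labels_add:
  assumes "shifts_labels a d" "shifts_labels b e"
  shows "shifts_labels (a + b) (\<lambda>j. d j + e j)"
  using assms translation_joint[of b] unfolding shifts_labels_def
  by (simp add: translation_add add.assoc)

lemma shifts_labels_minus:
  assumes "shifts_labels a d"
  shows "shifts_labels (- a) (\<lambda>j. - d j)"
proof -
  have m: "translation (- a)" using assms translation_minus by (simp add: shifts_labels_def)
  have "label j (- a + v) = label j v + - d j" if "v \<in> joint_set" "j < num_grids D" for v j
  proof -
    have "label j (a + (- a + v)) = label j (- a + v) + d j"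
      using assms that translation_joint[OF m that(1)] unfolding shifts_labels_def by blast
    then show ?thesis by simp
  qed
  then show ?thesis using m by (simp add: shifts_labels_def)
qed

lemma shifts_labels_scale:
  assumes "shifts_labels a d"
  shows "shifts_labels (of_int k *\<^sub>R a) (\<lambda>j. k * d j)"
proof -
  have nat: "shifts_labels (of_nat n *\<^sub>R a) (\<lambda>j. int n * d j)" for n
  proof (induction n)
    case 0
    show ?case by (simp add: shifts_labels_def translation_def)
  next
    case (Suc n)
    then show ?case
      using shifts_labels_add[OF assms Suc] by (simp add: algebra_simps)
  qed
  show ?thesis
  proof (cases "k \<ge> 0")
    case True
    then show ?thesis using nat[of "nat k"] by simp
  next
    case False
    then show ?thesis using shifts_labels_minus[OF nat[of "nat (- k)"]] by simp
  qed
qed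

end

section \<open>Periodic tilings\<close>

locale periodic_parallelogram_tiling = parallelogram_tiling +
  fixes a\<^sub>1 a\<^sub>2 :: "real^2"
  assumes periodic: "periodic_framework (parallelogram_framework D len) a\<^sub>1 a\<^sub>2"
begin

abbreviation "G \<equiv> parallelogram_framework D len"
abbreviation "lattice \<equiv> lattice_vector a\<^sub>1 a\<^sub>2"

lemma cross2_basis: "cross2 a\<^sub>1 a\<^sub>2 \<noteq> 0"
  using periodic by (simp add: periodic_framework_def is_basis_iff_cross2)

lemma translation_basis: "translation a\<^sub>1" "translation a\<^sub>2"
  using periodic unfolding periodic_framework_def translation_def
    joints_parallelogram_framework bars_parallelogram_framework bar_set_def by auto

definition m\<^sub>1 :: "nat \<Rightarrow> int" where "m\<^sub>1 = (SOME d. shifts_labels a\<^sub>1 d)"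
definition m\<^sub>2 :: "nat \<Rightarrow> int" where "m\<^sub>2 = (SOME d. shifts_labels a\<^sub>2 d)"

lemma shifts_labels_lattice:
  "shifts_labels (lattice k\<^sub>1 k\<^sub>2) (\<lambda>j. k\<^sub>1 * m\<^sub>1 j + k\<^sub>2 * m\<^sub>2 j)"
proof -
  have "shifts_labels a\<^sub>1 m\<^sub>1" "shifts_labels a\<^sub>2 m\<^sub>2"
    unfolding m\<^sub>1_def m\<^sub>2_def using shifts_labels_exists translation_basis by (metis someI)+
  then show ?thesis
    unfolding lattice_vector_def by (intro shifts_labels_add shifts_labels_scale)
qed

lemma translation_lattice: "translation (lattice k\<^sub>1 k\<^sub>2)"
  using shifts_labels_lattice by (simp add: shifts_labels_def)

lemma joint_lattice: "v \<in> joint_set \<Longrightarrow> lattice k\<^sub>1 k\<^sub>2 + v \<in> joint_set"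
  using translation_lattice translation_joint by blast

lemma label_lattice:
  "v \<in> joint_set \<Longrightarrow> j < num_grids D \<Longrightarrow>
    label j (lattice k\<^sub>1 k\<^sub>2 + v) = label j v + k\<^sub>1 * m\<^sub>1 j + k\<^sub>2 * m\<^sub>2 j"
  using shifts_labels_lattice[of k\<^sub>1 k\<^sub>2] by (simp add: shifts_labels_def)

lemma lattice_uminus: "lattice (- k\<^sub>1) (- k\<^sub>2) = - lattice k\<^sub>1 k\<^sub>2"
  by (simp add: lattice_vector_def)

lemma lattice_add: "lattice k\<^sub>1 k\<^sub>2 + lattice l\<^sub>1 l\<^sub>2 = lattice (k\<^sub>1 + l\<^sub>1) (k\<^sub>2 + l\<^sub>2)"
  by (simp add: lattice_vector_def scaleR_add_left)

text \<open>The radius is the one of \<open>lattice_vector_near\<close>, so the ball meets every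
  orbit of joints.\<close>

definition base_joints :: "(real^2) set" where
  "base_joints = {v \<in> joint_set. norm v \<le> norm a\<^sub>1 + norm a\<^sub>2}"

lemma finite_base_joints: "finite base_joints"
  unfolding base_joints_def by (rule finite_joint_set_ball)

lemma joint_base:
  assumes "v \<in> joint_set"
  obtains k\<^sub>1 k\<^sub>2 w where "w \<in> base_joints" "v = lattice k\<^sub>1 k\<^sub>2 + w"
proof -
  obtain k\<^sub>1 k\<^sub>2 where k: "norm (v - lattice k\<^sub>1 k\<^sub>2) \<le> norm a\<^sub>1 + norm a\<^sub>2"
    using lattice_vector_near[OF cross2_basis] by blast
  have "lattice (- k\<^sub>1) (- k\<^sub>2) + v \<in> joint_set"
    by (rule joint_lattice[OF assms])
  then have "v - lattice k\<^sub>1 k\<^sub>2 \<in> base_joints"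
    using k by (simp add: base_joints_def lattice_uminus)
  then show ?thesis
    by (intro that[of "v - lattice k\<^sub>1 k\<^sub>2" k\<^sub>1 k\<^sub>2]) auto
qed

text \<open>Every orbit of joints has a representative in \<open>base_joints\<close>, and an orbit
  of bars is determined by such a representative of its lower end together with the direction
  \<open>j\<close>.\<close>

lemma crystallographic_G: "crystallographic G a\<^sub>1 a\<^sub>2"
proof -
  have "countable joint_set"
  proof -
    have "joint_set \<subseteq> (\<Union>n::nat. {v \<in> joint_set. norm v \<le> real n})"
      using real_arch_simple by blast
    then show ?thesis
      by (rule countable_subset) (auto intro: countable_finite finite_joint_set_ball)
  qed
  moreover have "\<forall>e\<in>edges G. e \<subseteq> joint_set \<and> card e = 2"
  proof
    fix e assume "e \<in> edges G"
    then obtain j p where p: "only_on_grid j p" "e = {vertex p, vertex p + edge_vec j}"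
      by (auto simp: edges_parallelogram_framework)
    then have "edge_vec j \<noteq> 0" using edge_vec_nonzero by (auto simp: only_on_grid_def)
    then show "e \<subseteq> joint_set \<and> card e = 2"
      using p only_on_grid_joint_set[OF p(1)] by simp
  qed
  ultimately have bj: "bar_joint_framework G"
    by (simp add: bar_joint_framework_def verts_parallelogram_framework place_parallelogram_framework)
  let ?O = "\<lambda>x. {lattice k\<^sub>1 k\<^sub>2 + x | k\<^sub>1 k\<^sub>2. True}"
  let ?E = "\<lambda>e. {(+) (lattice k\<^sub>1 k\<^sub>2) ` e | k\<^sub>1 k\<^sub>2. True}"
  have E: "?E ((+) (lattice l\<^sub>1 l\<^sub>2) ` e) = ?E e" for l\<^sub>1 l\<^sub>2 e
  proof (intro set_eqI iffI)
    fix y assume "y \<in> ?E ((+) (lattice l\<^sub>1 l\<^sub>2) ` e)"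
    then obtain k\<^sub>1 k\<^sub>2 where "y = (+) (lattice k\<^sub>1 k\<^sub>2) ` ((+) (lattice l\<^sub>1 l\<^sub>2) ` e)" by blast
    then have "y = (+) (lattice (k\<^sub>1 + l\<^sub>1) (k\<^sub>2 + l\<^sub>2)) ` e"
      by (simp add: image_image lattice_add[symmetric] add.assoc)
    then show "y \<in> ?E e" by blast
  next
    fix y assume "y \<in> ?E e"
    then obtain k\<^sub>1 k\<^sub>2 where "y = (+) (lattice k\<^sub>1 k\<^sub>2) ` e" by blast
    then have "y = (+) (lattice (k\<^sub>1 - l\<^sub>1) (k\<^sub>2 - l\<^sub>2)) ` ((+) (lattice l\<^sub>1 l\<^sub>2) ` e)"
      by (simp add: image_image lattice_add add.assoc[symmetric])
    then show "y \<in> ?E ((+) (lattice l\<^sub>1 l\<^sub>2) ` e)" by blast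
  qed
  \<comment> \<open>Orbits of points are treated as orbits of singletons, so the argument for
    \<open>E\<close> covers them.\<close>
  have EO: "?E {x} = (\<lambda>y. {y}) ` ?O x" for x
    by auto
  have O: "?O (lattice l\<^sub>1 l\<^sub>2 + x) = ?O x" for l\<^sub>1 l\<^sub>2 x
  proof -
    have "(\<lambda>y. {y}) ` ?O (lattice l\<^sub>1 l\<^sub>2 + x) = (\<lambda>y. {y}) ` ?O x"
      using E[of l\<^sub>1 l\<^sub>2 "{x}"] unfolding EO[symmetric] by simp
    then show ?thesis
      by (rule inj_image_eq_iff[THEN iffD1, rotated]) (simp add: inj_def)
  qed
  have "?O ` joint_set \<subseteq> ?O ` base_joints"
  proof
    fix y assume "y \<in> ?O ` joint_set"
    then obtain v where v: "v \<in> joint_set" "y = ?O v" by blast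
    from v(1) obtain k\<^sub>1 k\<^sub>2 w where "w \<in> base_joints" "v = lattice k\<^sub>1 k\<^sub>2 + w" by (rule joint_base)
    then show "y \<in> ?O ` base_joints" using v(2) O by blast
  qed
  then have fO: "finite (?O ` joint_set)"
    using finite_base_joints finite_surj by blast
  have "?E ` bar_set \<subseteq> (\<lambda>(w, j). ?E {w, w + edge_vec j}) ` (base_joints \<times> {..<num_grids D})"
  proof
    fix y assume "y \<in> ?E ` bar_set"
    then obtain j p where p: "only_on_grid j p" "y = ?E {vertex p, vertex p + edge_vec j}"
      by (auto simp: bar_set_def)
    obtain k\<^sub>1 k\<^sub>2 w where w: "w \<in> base_joints" "vertex p = lattice k\<^sub>1 k\<^sub>2 + w"
      using only_on_grid_joint_set(1)[OF p(1)] by (rule joint_base)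
    have "{vertex p, vertex p + edge_vec j} = (+) (lattice k\<^sub>1 k\<^sub>2) ` {w, w + edge_vec j}"
      by (simp add: w(2) add.assoc)
    then have "y = ?E {w, w + edge_vec j}"
      using p(2) E[of k\<^sub>1 k\<^sub>2 "{w, w + edge_vec j}"] by (simp only:)
    moreover have "j < num_grids D" using p(1) by (simp add: only_on_grid_def)
    ultimately show "y \<in> (\<lambda>(w, j). ?E {w, w + edge_vec j}) ` (base_joints \<times> {..<num_grids D})"
      using w(1) by (intro image_eqI[of _ _ "(w, j)"]) auto
  qed
  then have fE: "finite (?E ` bar_set)"
    by (rule finite_subset) (intro finite_imageI finite_cartesian_product finite_base_joints finite_lessThan)
  show ?thesis
    using bj periodic fO fE unfolding crystallographic_def joints_parallelogram_framework
      bars_parallelogram_framework bar_set_def by blast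
qed

definition m :: "nat \<Rightarrow> real^2" where
  "m j = vector [of_int (m\<^sub>1 j), of_int (m\<^sub>2 j)]"

lemma m_nth [simp]: "m j $ 1 = of_int (m\<^sub>1 j)" "m j $ 2 = of_int (m\<^sub>2 j)"
  by (simp_all add: m_def)

text \<open>Otherwise the \<open>j\<close>-th label would be invariant under the lattice and hence
  bounded by its maximum on \<open>base_joints\<close>.\<close>

lemma m_nonzero:
  assumes j: "j < num_grids D"
  shows "m\<^sub>1 j \<noteq> 0 \<or> m\<^sub>2 j \<noteq> 0"
proof (rule ccontr)
  assume 0: "\<not> ?thesis"
  obtain v where v: "v \<in> joint_set" "label j v > Max (label j ` base_joints)"
    using label_unbounded[OF j] by blast
  from v(1) obtain k\<^sub>1 k\<^sub>2 w where w: "w \<in> base_joints" "v = lattice k\<^sub>1 k\<^sub>2 + w" by (rule joint_base)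
  then have "label j v = label j w"
    using 0 label_lattice[of w j k\<^sub>1 k\<^sub>2] j by (simp add: base_joints_def)
  then show False
    using v(2) Max_ge[of "label j ` base_joints" "label j w"] w(1) finite_base_joints
    by (simp add: not_less[symmetric])
qed

lemma m_vec_nonzero: "j < num_grids D \<Longrightarrow> m j \<noteq> 0"
  using m_nonzero[of j] by (auto simp: vec2_eq_iff)

definition ribbon_period :: "nat \<Rightarrow> real^2" where
  "ribbon_period j = lattice (m\<^sub>2 j) (- m\<^sub>1 j)"

text \<open>The linear functional whose value at a lattice vector is the shift of the
  \<open>j\<close>-th label; it vanishes along the ribbons.\<close>

definition height :: "nat \<Rightarrow> real^2 \<Rightarrow> real" where
  "height j x = cross2 (ribbon_period j) x / cross2 a\<^sub>1 a\<^sub>2"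

lemma height_add: "height j (x + y) = height j x + height j y"
  by (simp add: height_def cross2_linear add_divide_distrib)

lemma height_lattice: "height j (lattice k\<^sub>1 k\<^sub>2) = of_int (k\<^sub>1 * m\<^sub>1 j + k\<^sub>2 * m\<^sub>2 j)"
proof -
  have "cross2 (ribbon_period j) (lattice k\<^sub>1 k\<^sub>2) = of_int (k\<^sub>1 * m\<^sub>1 j + k\<^sub>2 * m\<^sub>2 j) * cross2 a\<^sub>1 a\<^sub>2"
    by (simp add: ribbon_period_def lattice_vector_def cross2_linear cross2_swap[of a\<^sub>1 a\<^sub>2] algebra_simps)
  then show ?thesis
    using cross2_basis by (simp add: height_def)
qed

text \<open>The difference of label and height is invariant under the lattice, so it takes only the
  finitely many values attained on \<open>base_joints\<close>.\<close>

lemma label_height_bounded: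
  assumes j: "j < num_grids D"
  obtains C where "C \<ge> 0" "\<And>v. v \<in> joint_set \<Longrightarrow> \<bar>of_int (label j v) - height j v\<bar> \<le> C"
proof -
  let ?g = "\<lambda>v. \<bar>of_int (label j v) - height j v\<bar>"
  define C where "C = Max (insert 0 (?g ` base_joints))"
  have fin: "finite (insert 0 (?g ` base_joints))" using finite_base_joints by simp
  have "?g v \<le> C" if v: "v \<in> joint_set" for v
  proof -
    from v obtain k\<^sub>1 k\<^sub>2 w where w: "w \<in> base_joints" "v = lattice k\<^sub>1 k\<^sub>2 + w" by (rule joint_base)
    have "?g v = ?g w"
      using label_lattice[of w j k\<^sub>1 k\<^sub>2] j w by (simp add: base_joints_def height_add height_lattice)
    then show ?thesis
      using Max_ge[OF fin, of "?g w"] w(1) by (simp add: C_def)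
  qed
  moreover have "C \<ge> 0" unfolding C_def using Max_ge[OF fin, of 0] by simp
  ultimately show ?thesis using that by blast
qed

subsection \<open>The zero mode spectrum\<close>

text \<open>Periods in the kernel of \<open>m j\<close> move an edge along its own ribbon, where a
  flex must repeat its velocity difference.\<close>

lemma translated_edge_lattice:
  assumes p: "only_on_grid j p" and k: "k\<^sub>1 * m\<^sub>1 j + k\<^sub>2 * m\<^sub>2 j = 0"
  obtains q where "only_on_grid j q" "vertex q = lattice k\<^sub>1 k\<^sub>2 + vertex p"
    "grid_index D j q = grid_index D j p"
proof -
  obtain q where q: "only_on_grid j q" "vertex q = lattice k\<^sub>1 k\<^sub>2 + vertex p"
    using translation_edge[OF translation_lattice p] by blast
  have j: "j < num_grids D" using p by (simp add: only_on_grid_def)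
  have "label j (vertex q) = label j (vertex p)"
    unfolding q(2) using label_lattice[OF only_on_grid_joint_set(1)[OF p] j, of k\<^sub>1 k\<^sub>2] k by simp
  then have "grid_index D j q = grid_index D j p" using j by simp
  then show ?thesis using that q by blast
qed

lemma zero_mode_spectrum_eq:
  "zero_mode_spectrum G a\<^sub>1 a\<^sub>2 =
    {\<gamma>. \<exists>j<num_grids D. \<exists>c. \<exists>z\<in>integer_vectors. \<gamma> = z + c *\<^sub>R m j}" (is "_ = ?R")
proof
  show "?R \<subseteq> zero_mode_spectrum G a\<^sub>1 a\<^sub>2"
  proof
    fix \<gamma> assume "\<gamma> \<in> ?R"
    then obtain j c z where j: "j < num_grids D" and z: "z \<in> integer_vectors" and \<gamma>: "\<gamma> = z + c *\<^sub>R m j"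
      by blast
    define e where "e x = exp (\<i> * complex_of_real (2 * pi * x))" for x
    have e_add: "e (x + y) = e x * e y" for x y
      by (simp add: e_def exp_add[symmetric] algebra_simps)
    define u where "u v = e (c * of_int (label j v)) *s constant_field (perp (normal D j)) v" for v
    have "infinitesimal_flex G u"
      by (rule infinitesimal_flex_of_label[OF j, of u "\<lambda>k. e (c * of_int k)"]) (simp add: u_def)
    moreover have "\<exists>x\<in>joints G. u x \<noteq> 0"
      using joint_set_nonempty normal_nonzero[OF j]
      by (auto simp: joints_parallelogram_framework u_def e_def)
    moreover have "u (x + lattice k\<^sub>1 k\<^sub>2) = e (of_int k\<^sub>1 * \<gamma> $ 1 + of_int k\<^sub>2 * \<gamma> $ 2) *s u x"
      if x: "x \<in> joints G" for x k\<^sub>1 k\<^sub>2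
    proof -
      have x: "x \<in> joint_set" using x by (simp add: joints_parallelogram_framework)
      have "of_int k\<^sub>1 * z $ 1 + of_int k\<^sub>2 * z $ 2 \<in> \<int>"
        using z by (auto simp: integer_vectors_def)
      then have 1: "e (of_int k\<^sub>1 * z $ 1 + of_int k\<^sub>2 * z $ 2) = 1"
        unfolding e_def exp_2pi_eq_1_iff .
      have g: "of_int k\<^sub>1 * \<gamma> $ 1 + of_int k\<^sub>2 * \<gamma> $ 2 =
          (of_int k\<^sub>1 * z $ 1 + of_int k\<^sub>2 * z $ 2) + c * of_int (k\<^sub>1 * m\<^sub>1 j + k\<^sub>2 * m\<^sub>2 j)"
        by (simp add: \<gamma> algebra_simps)
      have "label j (x + lattice k\<^sub>1 k\<^sub>2) = (k\<^sub>1 * m\<^sub>1 j + k\<^sub>2 * m\<^sub>2 j) + label j x"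
        using label_lattice[OF x j, of k\<^sub>1 k\<^sub>2] by (simp add: add.commute)
      then have "c * of_int (label j (x + lattice k\<^sub>1 k\<^sub>2)) =
          c * of_int (k\<^sub>1 * m\<^sub>1 j + k\<^sub>2 * m\<^sub>2 j) + c * of_int (label j x)"
        by (simp add: algebra_simps)
      then have "u (x + lattice k\<^sub>1 k\<^sub>2) = (e (c * of_int (k\<^sub>1 * m\<^sub>1 j + k\<^sub>2 * m\<^sub>2 j)) * e (c * of_int (label j x))) *s
          constant_field (perp (normal D j)) (x + lattice k\<^sub>1 k\<^sub>2)"
        unfolding u_def by (simp only: e_add)
      moreover have "e (of_int k\<^sub>1 * \<gamma> $ 1 + of_int k\<^sub>2 * \<gamma> $ 2) = e (c * of_int (k\<^sub>1 * m\<^sub>1 j + k\<^sub>2 * m\<^sub>2 j))"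
        unfolding g e_add[of "of_int k\<^sub>1 * z $ 1 + of_int k\<^sub>2 * z $ 2"] 1 by simp
      ultimately show ?thesis
        by (simp add: u_def vector_smult_assoc constant_field_def)
    qed
    ultimately show "\<gamma> \<in> zero_mode_spectrum G a\<^sub>1 a\<^sub>2"
      unfolding zero_mode_spectrum_def e_def by blast
  qed
next
  show "zero_mode_spectrum G a\<^sub>1 a\<^sub>2 \<subseteq> ?R"
  proof
    fix \<gamma> assume "\<gamma> \<in> zero_mode_spectrum G a\<^sub>1 a\<^sub>2"
    then obtain u x where flex: "infinitesimal_flex G u" and x: "x \<in> joint_set" "u x \<noteq> 0"
      and bloch: "\<And>x k\<^sub>1 k\<^sub>2. x \<in> joint_set \<Longrightarrow> u (lattice k\<^sub>1 k\<^sub>2 + x) =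
          exp (\<i> * complex_of_real (2 * pi * (of_int k\<^sub>1 * \<gamma> $ 1 + of_int k\<^sub>2 * \<gamma> $ 2))) *s u x"
      unfolding zero_mode_spectrum_def joints_parallelogram_framework
      by (auto simp: add.commute)
    show "\<gamma> \<in> ?R"
    proof (cases "\<forall>j p. only_on_grid j p \<longrightarrow> u (vertex p + edge_vec j) = u (vertex p)")
      case True
      then have const: "u v = u x" if "v \<in> joint_set" for v
        using edge_invariant_imp_constant[of u] that x(1) by blast
      have "of_int k\<^sub>1 * \<gamma> $ 1 + of_int k\<^sub>2 * \<gamma> $ 2 \<in> \<int>" for k\<^sub>1 k\<^sub>2
      proof -
        have "u x = exp (\<i> * complex_of_real (2 * pi * (of_int k\<^sub>1 * \<gamma> $ 1 + of_int k\<^sub>2 * \<gamma> $ 2))) *s u x"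
          using bloch[OF x(1), of k\<^sub>1 k\<^sub>2] const[OF joint_lattice[OF x(1), of k\<^sub>1 k\<^sub>2]] by simp
        then have "exp (\<i> * complex_of_real (2 * pi * (of_int k\<^sub>1 * \<gamma> $ 1 + of_int k\<^sub>2 * \<gamma> $ 2))) = 1"
          using x(2) by (metis vector_mul_rcancel vector_smult_lid)
        then show ?thesis by (simp only: exp_2pi_eq_1_iff)
      qed
      from this[of 1 0] this[of 0 1] have "\<gamma> \<in> integer_vectors"
        by (simp add: integer_vectors_def forall_2)
      moreover have "\<gamma> = \<gamma> + 0 *\<^sub>R m 0" "0 < num_grids D" using two_le_num_grids by auto
      ultimately show ?thesis by blast
    next
      case False
      then obtain j p where p: "only_on_grid j p" and ne: "u (vertex p + edge_vec j) - u (vertex p) \<noteq> 0"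
        by auto
      have j: "j < num_grids D" using p by (simp add: only_on_grid_def)
      \<comment> \<open>Dividing by the gcd yields a primitive kernel period
        \<open>(n2, - n1)\<close>. The period \<open>(m\<^sub>2 j, - m\<^sub>1 j)\<close> alone
        would fix the phase only up to fractions with the gcd as denominator.\<close>
      have gcd: "gcd (m\<^sub>1 j) (m\<^sub>2 j) \<noteq> 0" using m_nonzero[OF j] by simp
      then obtain n1 n2 where n: "m\<^sub>1 j = n1 * gcd (m\<^sub>1 j) (m\<^sub>2 j)" "m\<^sub>2 j = n2 * gcd (m\<^sub>1 j) (m\<^sub>2 j)" "coprime n1 n2"
        using gcd_coprime_exists by blast
      define g where "g = gcd (m\<^sub>1 j) (m\<^sub>2 j)"
      have ng: "m\<^sub>1 j = n1 * g" "m\<^sub>2 j = n2 * g" using n by (simp_all add: g_def)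
      have "n2 * m\<^sub>1 j + (- n1) * m\<^sub>2 j = 0" by (simp add: ng)
      then obtain q where q: "only_on_grid j q" "vertex q = lattice n2 (- n1) + vertex p"
          "grid_index D j q = grid_index D j p"
        using translated_edge_lattice[OF p] by blast
      define E where "E = exp (\<i> * complex_of_real (2 * pi * (of_int n2 * \<gamma> $ 1 + of_int (- n1) * \<gamma> $ 2)))"
      have "u (vertex q + edge_vec j) - u (vertex q) = E *s (u (vertex p + edge_vec j) - u (vertex p))"
        using bloch[OF only_on_grid_joint_set(1)[OF p], of n2 "- n1"]
          bloch[OF only_on_grid_joint_set(2)[OF p], of n2 "- n1"]
        unfolding q(2) E_def by (simp add: add.assoc vector_ssub_ldistrib)
      then have "E *s (u (vertex p + edge_vec j) - u (vertex p)) = u (vertex p + edge_vec j) - u (vertex p)"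
        using flex_difference_constant_on_ribbon[OF flex q(1) p q(3)] by metis
      then have "E = 1"
        using ne by (metis vector_mul_rcancel vector_smult_lid)
      then have "of_int n2 * \<gamma> $ 1 + of_int (- n1) * \<gamma> $ 2 \<in> \<int>"
        unfolding E_def exp_2pi_eq_1_iff .
      then obtain n where n': "of_int n2 * \<gamma> $ 1 - of_int n1 * \<gamma> $ 2 = of_int n"
        by (auto elim: Ints_cases)
      obtain b1 b2 where "b1 * n1 + b2 * n2 = gcd n1 n2"
        using bezout_int by blast
      then have b: "b1 * n1 + b2 * n2 = 1" using n(3) by simp
      \<comment> \<open>The Bezout coefficients give an integer vector with the same value
        \<open>n\<close> of the form, so \<open>\<gamma> - z\<close> is parallel to
        \<open>m j\<close>.\<close>
      define z :: "real^2" where "z = vector [of_int (n * b2), of_int (- n * b1)]"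
      have z: "z \<in> integer_vectors"
        by (simp add: integer_vectors_def forall_2 z_def)
      have "of_int n2 * z $ 1 - of_int n1 * z $ 2 = (of_int (n * (b1 * n1 + b2 * n2)) :: real)"
        by (simp add: z_def algebra_simps)
      then have "of_int n2 * (\<gamma> - z) $ 1 - of_int n1 * (\<gamma> - z) $ 2 = 0"
        using n' b by (simp add: algebra_simps)
      then have "of_int g * (of_int n2 * (\<gamma> - z) $ 1 - of_int n1 * (\<gamma> - z) $ 2) = 0" by simp
      then have "cross2 (m j) (\<gamma> - z) = 0"
        by (simp add: cross2_def ng algebra_simps)
      then obtain c where "\<gamma> - z = c *\<^sub>R m j"
        using cross2_eq_0_imp_multiple m_vec_nonzero[OF j] by blast
      then have "\<gamma> = z + c *\<^sub>R m j" by (simp add: algebra_simps)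
      then show ?thesis using j z by blast
    qed
  qed
qed

subsection \<open>Slippage lines are ribbon directions\<close>

lemma slippage_line_imp_ribbon_direction:
  assumes sl: "periodic_slippage_line G (span {\<alpha> *\<^sub>R a\<^sub>1 + \<beta> *\<^sub>R a\<^sub>2})"
  shows "\<exists>j<num_grids D. of_int (m\<^sub>1 j) * \<alpha> + of_int (m\<^sub>2 j) * \<beta> = 0"
proof (rule ccontr)
  assume "\<not> ?thesis"
  then have trans: "of_int (m\<^sub>1 j) * \<alpha> + of_int (m\<^sub>2 j) * \<beta> \<noteq> 0" if "j < num_grids D" for j
    using that by blast
  obtain t\<^sub>1 t\<^sub>2 b where H: "span {\<alpha> *\<^sub>R a\<^sub>1 + \<beta> *\<^sub>R a\<^sub>2} = span {t\<^sub>1}" and basis: "is_basis t\<^sub>1 t\<^sub>2" and b: "b \<noteq> 0"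
    and eps: "\<forall>\<epsilon>>0. \<exists>u. \<exists>M::nat. infinitesimal_flex G u \<and> M > 0 \<and>
           (\<forall>\<omega>. norm \<omega> = 1 \<longrightarrow>
              infinitesimal_flex G (modulation (phase_field \<omega> t\<^sub>1 (real M *\<^sub>R t\<^sub>2)) u)) \<and>
           (\<forall>\<omega>. norm \<omega> = 1 \<longrightarrow>
              mostly_close (joints G) \<epsilon>
                (modulation (phase_field \<omega> t\<^sub>1 (real M *\<^sub>R t\<^sub>2)) u)
                (modulation (phase_field \<omega> t\<^sub>1 (real M *\<^sub>R t\<^sub>2)) (constant_field b)))"
    using sl unfolding periodic_slippage_line_def by blast
  \<comment> \<open>Below the size of \<open>b\<close>, so that the zero field is far from it at
    every joint; at most 1, so that a finite set cannot have fewer than \<open>\<epsilon>\<close>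
    times its own number of elements.\<close>
  define \<epsilon> where "\<epsilon> = min 1 (norm (constant_field b 0) / 2)"
  have nb: "norm (constant_field b 0) > 0" using b by simp
  have \<epsilon>: "\<epsilon> > 0" "\<epsilon> \<le> 1" "norm (constant_field b 0) > \<epsilon>" using nb by (auto simp: \<epsilon>_def min_less_iff_disj)
  obtain u and M :: nat where "M > 0"
    and mflex: "\<And>\<omega>. norm \<omega> = 1 \<Longrightarrow> infinitesimal_flex G (modulation (phase_field \<omega> t\<^sub>1 (real M *\<^sub>R t\<^sub>2)) u)"
    and close: "\<And>\<omega>. norm \<omega> = 1 \<Longrightarrow> mostly_close (joints G) \<epsilon>
                (modulation (phase_field \<omega> t\<^sub>1 (real M *\<^sub>R t\<^sub>2)) u)
                (modulation (phase_field \<omega> t\<^sub>1 (real M *\<^sub>R t\<^sub>2)) (constant_field b))"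
    using eps \<epsilon>(1) by blast
  have c12: "cross2 t\<^sub>1 t\<^sub>2 \<noteq> 0" using basis by (simp add: is_basis_iff_cross2)
  then have cM: "cross2 t\<^sub>1 (real M *\<^sub>R t\<^sub>2) \<noteq> 0" using \<open>M > 0\<close> by (simp add: cross2_scale)
  define h where "h x = cross2 t\<^sub>1 x / cross2 t\<^sub>1 (real M *\<^sub>R t\<^sub>2)" for x
  have h_add: "h (x + y) = h x + h y" for x y by (simp add: h_def cross2_linear add_divide_distrib)
  have phase: "phase_field \<omega> t\<^sub>1 (real M *\<^sub>R t\<^sub>2) x = \<omega> powi \<lfloor>h x\<rfloor>" for \<omega> x
    unfolding h_def by (rule phase_field_eq[OF cM])
  have "t\<^sub>1 \<in> span {\<alpha> *\<^sub>R a\<^sub>1 + \<beta> *\<^sub>R a\<^sub>2}"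
    unfolding H by (simp add: span_base)
  then obtain c where c: "t\<^sub>1 = c *\<^sub>R (\<alpha> *\<^sub>R a\<^sub>1 + \<beta> *\<^sub>R a\<^sub>2)" by (auto simp: span_singleton)
  have "t\<^sub>1 \<noteq> 0" using c12 by (auto simp: cross2_def)
  then have "c \<noteq> 0" using c by auto
  \<comment> \<open>By transversality \<open>h\<close> is nonzero on the ribbon period. The sign of
    \<open>N\<close> follows that value, so that multiples of the period climb through the
    bands.\<close>
  have far: "\<exists>k\<^sub>1 k\<^sub>2. k\<^sub>1 * m\<^sub>1 j + k\<^sub>2 * m\<^sub>2 j = 0 \<and> h (lattice k\<^sub>1 k\<^sub>2) \<ge> R" if j: "j < num_grids D" for j R
  proof -
    have "cross2 t\<^sub>1 (ribbon_period j) = - c * (of_int (m\<^sub>1 j) * \<alpha> + of_int (m\<^sub>2 j) * \<beta>) * cross2 a\<^sub>1 a\<^sub>2"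
      by (simp add: c ribbon_period_def lattice_vector_def cross2_linear cross2_swap[of a\<^sub>1 a\<^sub>2] algebra_simps)
    then have h0: "h (ribbon_period j) \<noteq> 0"
      using cross2_basis cM trans[OF j] \<open>c \<noteq> 0\<close> by (simp add: h_def)
    define N where "N = (if h (ribbon_period j) > 0 then \<lceil>R / h (ribbon_period j)\<rceil> else \<lfloor>R / h (ribbon_period j)\<rfloor>)"
    have "lattice (N * m\<^sub>2 j) (- N * m\<^sub>1 j) = of_int N *\<^sub>R ribbon_period j"
      by (simp add: ribbon_period_def lattice_vector_def algebra_simps)
    then have "h (lattice (N * m\<^sub>2 j) (- N * m\<^sub>1 j)) = of_int N * h (ribbon_period j)"
      by (simp add: h_def cross2_scale)
    moreover have "of_int N * h (ribbon_period j) \<ge> R"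
    proof (cases "h (ribbon_period j) > 0")
      case True
      then have "R / h (ribbon_period j) \<le> of_int N" by (simp add: N_def)
      then show ?thesis using True by (simp add: pos_divide_le_eq)
    next
      case False
      then have neg: "h (ribbon_period j) < 0" using h0 by simp
      have "of_int N \<le> R / h (ribbon_period j)" using False by (simp add: N_def)
      then show ?thesis using neg by (simp add: neg_le_divide_eq)
    qed
    ultimately show ?thesis
      by (intro exI[of _ "N * m\<^sub>2 j"] exI[of _ "- N * m\<^sub>1 j"]) simp
  qed
  have edge: "u (vertex p + edge_vec j) = u (vertex p) \<and>
      (\<lfloor>h (vertex p + edge_vec j)\<rfloor> \<noteq> \<lfloor>h (vertex p)\<rfloor> \<longrightarrow> u (vertex p) = 0)" if p: "only_on_grid j p" for j p
  proof -
    have j: "j < num_grids D" using p by (simp add: only_on_grid_def)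
    let ?v = "vertex p" and ?w = "vertex p + edge_vec j"
    \<comment> \<open>The distance between the ends plus 1 puts both ends of the moved edge in
      strictly higher bands than both ends of the original.\<close>
    obtain k\<^sub>1 k\<^sub>2 where k: "k\<^sub>1 * m\<^sub>1 j + k\<^sub>2 * m\<^sub>2 j = 0" "h (lattice k\<^sub>1 k\<^sub>2) \<ge> \<bar>h ?v - h ?w\<bar> + 1"
      using far[OF j] by blast
    obtain q where q: "only_on_grid j q" "vertex q = lattice k\<^sub>1 k\<^sub>2 + ?v" "grid_index D j q = grid_index D j p"
      using translated_edge_lattice[OF p k(1)] by blast
    let ?v' = "vertex q" and ?w' = "vertex q + edge_vec j"
    have hv: "h ?v' = h ?v + h (lattice k\<^sub>1 k\<^sub>2)" "h ?w' = h ?w + h (lattice k\<^sub>1 k\<^sub>2)"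
      unfolding q(2) by (simp_all add: h_add)
    have lt: "\<lfloor>h ?w\<rfloor> < \<lfloor>h ?w'\<rfloor>" "\<lfloor>h ?v\<rfloor> < \<lfloor>h ?w'\<rfloor>" "\<lfloor>h ?w\<rfloor> < \<lfloor>h ?v'\<rfloor>" "\<lfloor>h ?v\<rfloor> < \<lfloor>h ?v'\<rfloor>"
      using hv k(2) by linarith+
    have zero: "u ?w $ i * \<omega> powi \<lfloor>h ?w\<rfloor> - u ?v $ i * \<omega> powi \<lfloor>h ?v\<rfloor> = 0" if \<omega>: "norm \<omega> = 1" for \<omega> i
    proof (rule laurent_low_part_eq_0[OF _ lt \<omega>])
      fix \<omega> :: complex assume "norm \<omega> = 1"
      from flex_difference_constant_on_ribbon[OF mflex[OF this] p q(1) q(3)[symmetric]]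
      have "(\<omega> powi \<lfloor>h ?w\<rfloor> *s u ?w - \<omega> powi \<lfloor>h ?v\<rfloor> *s u ?v) $ i = (\<omega> powi \<lfloor>h ?w'\<rfloor> *s u ?w' - \<omega> powi \<lfloor>h ?v'\<rfloor> *s u ?v') $ i"
        unfolding modulation_def phase by simp
      then show "u ?w $ i * \<omega> powi \<lfloor>h ?w\<rfloor> - u ?v $ i * \<omega> powi \<lfloor>h ?v\<rfloor> = u ?w' $ i * \<omega> powi \<lfloor>h ?w'\<rfloor> - u ?v' $ i * \<omega> powi \<lfloor>h ?v'\<rfloor>"
        by (simp add: mult.commute)
    qed
    have eq: "u ?w = u ?v"
      using zero[of 1] by (simp add: vec_eq_iff)
    moreover have "u ?v = 0" if ne: "\<lfloor>h ?w\<rfloor> \<noteq> \<lfloor>h ?v\<rfloor>"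
    proof -
      \<comment> \<open>With \<open>\<omega> powi d = - 1\<close> the ends receive opposite phases,
        and the vanishing difference becomes a nonzero multiple of \<open>u ?v\<close>.\<close>
      define d where "d = \<lfloor>h ?w\<rfloor> - \<lfloor>h ?v\<rfloor>"
      define \<omega> where "\<omega> = exp (\<i> * complex_of_real (pi / of_int d))"
      have d: "d \<noteq> 0" using ne by (simp add: d_def)
      have "\<omega> powi d = exp (\<i> * complex_of_real pi)"
        using d by (simp add: \<omega>_def exp_power_int)
      then have w: "\<omega> powi d = - 1" by (simp add: exp_pi_i')
      have n: "norm \<omega> = 1" "\<omega> \<noteq> 0" by (simp_all add: \<omega>_def norm_exp_i_times)
      have "\<omega> powi \<lfloor>h ?w\<rfloor> = - (\<omega> powi \<lfloor>h ?v\<rfloor>)"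
        using power_int_add[of \<omega> "\<lfloor>h ?v\<rfloor>" d] n w by (simp add: d_def)
      then have "u ?v $ i = 0" for i
        using zero[OF n(1), of i] n(2) unfolding eq by (simp add: algebra_simps)
      then show ?thesis by (simp add: vec_eq_iff)
    qed
    ultimately show ?thesis by blast
  qed
  have const: "u v = u w" if "v \<in> joint_set" "w \<in> joint_set" for v w
    by (rule edge_invariant_imp_constant[of u, OF _ that]) (use edge in blast)
  \<comment> \<open>Otherwise all joints would lie in one band, although some lattice translation
    climbs by at least one.\<close>
  have "\<exists>j p. only_on_grid j p \<and> \<lfloor>h (vertex p + edge_vec j)\<rfloor> \<noteq> \<lfloor>h (vertex p)\<rfloor>"
  proof (rule ccontr)
    assume "\<not> ?thesis"
    then have *: "\<lfloor>h v\<rfloor> = \<lfloor>h w\<rfloor>" if "v \<in> joint_set" "w \<in> joint_set" for v w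
      by (intro edge_invariant_imp_constant[of "\<lambda>v. \<lfloor>h v\<rfloor>", OF _ that]) blast
    obtain v where v: "v \<in> joint_set" using joint_set_nonempty by blast
    obtain k\<^sub>1 k\<^sub>2 where "h (lattice k\<^sub>1 k\<^sub>2) \<ge> 1" using far[of 0 1] two_le_num_grids by auto
    then have "\<lfloor>h (lattice k\<^sub>1 k\<^sub>2 + v)\<rfloor> \<noteq> \<lfloor>h v\<rfloor>" unfolding h_add by linarith
    then show False using *[OF joint_lattice[OF v] v] by blast
  qed
  then obtain j p where "only_on_grid j p" "u (vertex p) = 0" using edge by blast
  then have u0: "u v = 0" if "v \<in> joint_set" for v
    using const[OF that only_on_grid_joint_set(1)] by simp
  have bad: "{p \<in> joint_set \<inter> S. norm (modulation (phase_field 1 t\<^sub>1 (real M *\<^sub>R t\<^sub>2)) u p -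
      modulation (phase_field 1 t\<^sub>1 (real M *\<^sub>R t\<^sub>2)) (constant_field b) p) > \<epsilon>} = joint_set \<inter> S" for S
    using u0 \<epsilon>(3) by (auto simp: modulation_def phase constant_field_def)
  obtain N0 :: real where N0: "\<forall>N\<ge>N0. \<forall>c S. S = (+) c ` cbox (vec (- N)) (vec N) \<longrightarrow>
      real (card (joint_set \<inter> S)) < \<epsilon> * real (card (joint_set \<inter> S))"
    using close[of 1] unfolding mostly_close_def joints_parallelogram_framework bad by auto
  then obtain S :: "(real^2) set" where "real (card (joint_set \<inter> S)) < \<epsilon> * real (card (joint_set \<inter> S))"
    by blast
  moreover have "\<epsilon> * real (card (joint_set \<inter> S)) \<le> 1 * real (card (joint_set \<inter> S))"
    using \<epsilon>(2) by (intro mult_right_mono) auto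
  ultimately show False by simp
qed

subsection \<open>Ribbon directions are slippage lines\<close>

definition joints_in_square :: "real^2 \<Rightarrow> real \<Rightarrow> (real^2) set" where
  "joints_in_square c N = joint_set \<inter> (+) c ` cbox (vec (- N)) (vec N)"

lemma mem_joints_in_square:
  "x \<in> joints_in_square c N \<longleftrightarrow> x \<in> joint_set \<and> (\<forall>i. \<bar>x $ i - c $ i\<bar> \<le> N)"
  by (simp add: joints_in_square_def mem_square_iff)

lemma finite_joints_in_square: "finite (joints_in_square c N)"
proof -
  have "bounded ((+) c ` cbox (vec (- N)) (vec N))"
    by (intro bounded_translation bounded_cbox)
  then obtain R where "\<forall>x\<in>(+) c ` cbox (vec (- N)) (vec N). norm x \<le> R"
    by (auto simp: bounded_iff)
  then have "joints_in_square c N \<subseteq> {v \<in> joint_set. norm v \<le> R}"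
    unfolding joints_in_square_def by blast
  then show ?thesis
    using finite_joint_set_ball finite_subset by blast
qed

lemma joints_in_square_nonempty:
  "\<exists>N\<^sub>1. \<forall>N\<ge>N\<^sub>1. \<forall>c. joints_in_square c N \<noteq> {}"
proof -
  obtain v where v: "v \<in> joint_set" using joint_set_nonempty by blast
  have "joints_in_square c N \<noteq> {}" if N: "N \<ge> norm a\<^sub>1 + norm a\<^sub>2" for N c
  proof -
    obtain k\<^sub>1 k\<^sub>2 where k: "norm (c - v - lattice k\<^sub>1 k\<^sub>2) \<le> norm a\<^sub>1 + norm a\<^sub>2"
      using lattice_vector_near[OF cross2_basis] by blast
    have "\<bar>(lattice k\<^sub>1 k\<^sub>2 + v) $ i - c $ i\<bar> \<le> N" for i
      using component_le_norm_cart[of "c - v - lattice k\<^sub>1 k\<^sub>2" i] k N by simp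
    then have "lattice k\<^sub>1 k\<^sub>2 + v \<in> joints_in_square c N"
      using joint_lattice[OF v] by (simp add: mem_joints_in_square)
    then show ?thesis by blast
  qed
  then show ?thesis by blast
qed

text \<open>A slightly enlarged square is covered by four lattice translates of the original one.\<close>

lemma card_joints_in_enlarged_square:
  assumes N: "N \<ge> 4 * R" "N \<ge> 4 * (norm a\<^sub>1 + norm a\<^sub>2)" "N > 0"
  shows "card (joints_in_square c (N + R)) \<le> 4 * card (joints_in_square c N)"
proof -
  \<comment> \<open>The centres of the four quadrants of the square, relative to \<open>c\<close>;
    the covering translations approximate them by lattice vectors.\<close>
  define corner :: "bool \<times> bool \<Rightarrow> real^2" where
    "corner s = vector [if fst s then N / 2 else - (N / 2), if snd s then N / 2 else - (N / 2)]" for s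
  have "\<exists>\<tau>. (\<exists>k\<^sub>1 k\<^sub>2. \<tau> = lattice k\<^sub>1 k\<^sub>2) \<and> norm (corner s - \<tau>) \<le> norm a\<^sub>1 + norm a\<^sub>2" for s
    using lattice_vector_near[OF cross2_basis, of "corner s"] by blast
  then obtain \<tau> where lat: "\<And>s. \<exists>k\<^sub>1 k\<^sub>2. \<tau> s = lattice k\<^sub>1 k\<^sub>2"
    and near: "\<And>s. norm (corner s - \<tau> s) \<le> norm a\<^sub>1 + norm a\<^sub>2"
    by metis
  have "joints_in_square c (N + R) \<subseteq> (\<Union>s\<in>UNIV. (+) (\<tau> s) ` joints_in_square c N)"
  proof
    fix x assume x: "x \<in> joints_in_square c (N + R)"
    define s where "s = (x $ 1 \<ge> c $ 1, x $ 2 \<ge> c $ 2)"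
    have xc: "\<bar>x $ i - c $ i\<bar> \<le> N + R" for i using x by (simp add: mem_joints_in_square)
    \<comment> \<open>In its quadrant a point is at most \<open>N / 2 + R\<close> from the centre in
      each coordinate. The remaining \<open>N / 4\<close> absorbs the lattice approximation.\<close>
    have d: "\<bar>x $ i - c $ i - corner s $ i\<bar> \<le> 3 * N / 4" for i
    proof -
      have "corner s $ i = (if x $ i \<ge> c $ i then N / 2 else - (N / 2))"
        using exhaust_2[of i] by (auto simp: corner_def s_def)
      then have "corner s $ i = N / 2 \<and> x $ i \<ge> c $ i \<or> corner s $ i = - (N / 2) \<and> x $ i < c $ i"
        by (simp split: if_splits)
      then show ?thesis
        using xc[of i] N by linarith
    qed
    have "\<bar>(x - \<tau> s) $ i - c $ i\<bar> \<le> N" for i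
    proof -
      have "(x - \<tau> s) $ i - c $ i = (x $ i - c $ i - corner s $ i) + (corner s - \<tau> s) $ i" by simp
      then show ?thesis
        using d[of i] near[of s] component_le_norm_cart[of "corner s - \<tau> s" i] N(2)
          abs_triangle_ineq[of "x $ i - c $ i - corner s $ i" "(corner s - \<tau> s) $ i"] by argo
    qed
    moreover obtain k\<^sub>1 k\<^sub>2 where "\<tau> s = lattice k\<^sub>1 k\<^sub>2" using lat by blast
    then have "x - \<tau> s \<in> joint_set"
      using joint_lattice[of x "- k\<^sub>1" "- k\<^sub>2"] x by (simp add: lattice_uminus mem_joints_in_square)
    ultimately have "x - \<tau> s \<in> joints_in_square c N" by (simp add: mem_joints_in_square)
    then have "x \<in> (+) (\<tau> s) ` joints_in_square c N"
      by (intro image_eqI[of _ _ "x - \<tau> s"]) auto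
    then show "x \<in> (\<Union>s\<in>UNIV. (+) (\<tau> s) ` joints_in_square c N)" by blast
  qed
  then have "card (joints_in_square c (N + R)) \<le> card (\<Union>s\<in>UNIV. (+) (\<tau> s) ` joints_in_square c N)"
    by (intro card_mono) (simp_all add: finite_joints_in_square)
  also have "\<dots> \<le> (\<Sum>s\<in>UNIV. card ((+) (\<tau> s) ` joints_in_square c N))"
    by (rule card_UN_le) simp
  also have "\<dots> = 4 * card (joints_in_square c N)"
    by (simp add: card_image card_UNIV_bool flip: UNIV_Times_UNIV)
  finally show ?thesis .
qed

text \<open>The flex is \<open>perp (normal D j)\<close> on every ribbon of the \<open>j\<close>-th grid whose joints provably
  lie in a single band, and zero on the others. The exceptional joints lie within bounded height
  of the band boundaries, so \<open>L\<close> translates of them towards the interior of the band are disjoint;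
  this bounds their density.\<close>

lemma ribbon_period_slippage_line:
  assumes j: "j < num_grids D"
  shows "periodic_slippage_line G (span {ribbon_period j})"
proof -
  \<comment> \<open>A lattice vector, so its multiples carry joints to joints; its height
    \<open>Q\<close> is a positive integer.\<close>
  define t where "t = lattice (m\<^sub>1 j) (m\<^sub>2 j)"
  define Q where "Q = m\<^sub>1 j * m\<^sub>1 j + m\<^sub>2 j * m\<^sub>2 j"
  have "Q > 0"
    using m_nonzero[OF j] sum_squares_gt_zero_iff[of "m\<^sub>1 j" "m\<^sub>2 j"] by (simp add: Q_def)
  have ht: "height j t = of_int Q"
    by (simp add: t_def Q_def height_lattice)
  have ct: "cross2 (ribbon_period j) t = of_int Q * cross2 a\<^sub>1 a\<^sub>2"
    using ht cross2_basis by (simp add: height_def field_simps)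
  have basis: "is_basis (ribbon_period j) t"
    using ct cross2_basis \<open>Q > 0\<close> by (simp add: is_basis_iff_cross2)
  obtain C where C: "C \<ge> 0" "\<And>v. v \<in> joint_set \<Longrightarrow> \<bar>of_int (label j v) - height j v\<bar> \<le> C"
    using label_height_bounded[OF j] by blast
  let ?b = "perp (normal D j)"
  have "?b \<noteq> 0" using normal_nonzero[OF j] by simp
  moreover have "\<exists>u. \<exists>M::nat. infinitesimal_flex G u \<and> M > 0 \<and>
           (\<forall>\<omega>. norm \<omega> = 1 \<longrightarrow>
              infinitesimal_flex G (modulation (phase_field \<omega> (ribbon_period j) (real M *\<^sub>R t)) u)) \<and>
           (\<forall>\<omega>. norm \<omega> = 1 \<longrightarrow>
              mostly_close (joints G) \<epsilon>
                (modulation (phase_field \<omega> (ribbon_period j) (real M *\<^sub>R t)) u)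
                (modulation (phase_field \<omega> (ribbon_period j) (real M *\<^sub>R t)) (constant_field ?b)))"
    if \<epsilon>: "\<epsilon> > 0" for \<epsilon>
  proof -
    \<comment> \<open>\<open>L > 4 / \<epsilon>\<close> pays for the factor 4 of the enlarged
      square. Exceptional joints lie within \<open>2 * C\<close> of a band boundary, so steps of
      more than \<open>4 * C\<close> keep their translates apart. With \<open>M = L * w\<close> a
      band is exactly \<open>L\<close> such steps high.\<close>
    define L where "L = Suc (nat \<lceil>4 / \<epsilon>\<rceil>)"
    define w where "w = Suc (nat \<lceil>4 * C\<rceil>)"
    define M where "M = L * w"
    have M: "M > 0" by (simp add: M_def L_def w_def)
    have L: "4 < \<epsilon> * real L"
    proof -
      have "4 / \<epsilon> < real L" unfolding L_def by linarith
      then show ?thesis using \<epsilon> by (simp add: pos_divide_less_eq mult.commute)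
    qed
    have w: "4 * C < real w" unfolding w_def by linarith
    define P where "P = real M * of_int Q"
    have P: "P > 0" using M \<open>Q > 0\<close> by (simp add: P_def)
    have phase: "phase_field \<omega> (ribbon_period j) (real M *\<^sub>R t) x = \<omega> powi \<lfloor>height j x / P\<rfloor>" for \<omega> x
    proof -
      have "cross2 (ribbon_period j) (real M *\<^sub>R t) \<noteq> 0"
        using ct M \<open>Q > 0\<close> cross2_basis by (simp add: cross2_scale)
      moreover have "cross2 (ribbon_period j) x / cross2 (ribbon_period j) (real M *\<^sub>R t) = height j x / P"
        by (simp add: ct cross2_scale height_def P_def)
      ultimately show ?thesis using phase_field_eq by metis
    qed
    \<comment> \<open>Joints with label \<open>k\<close> have heights between \<open>k - C\<close>
      and \<open>k + C\<close>; the value is 1 exactly when this whole interval lies in one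
      band.\<close>
    define F :: "int \<Rightarrow> complex" where
      "F k = (if \<lfloor>(of_int k - C) / P\<rfloor> = \<lfloor>(of_int k + C) / P\<rfloor> then 1 else 0)" for k
    define u where "u v = F (label j v) *s constant_field ?b v" for v
    have flex: "infinitesimal_flex G u"
      by (rule infinitesimal_flex_of_label[OF j, of u F]) (simp add: u_def)
    have mflex: "infinitesimal_flex G (modulation (phase_field \<omega> (ribbon_period j) (real M *\<^sub>R t)) u)" for \<omega>
    \<comment> \<open>Where \<open>F\<close> is nonzero the phase depends on the label alone, so the
      modulated field again has the form required for a flex.\<close>
    proof (rule infinitesimal_flex_of_label[OF j, of _ "\<lambda>k. \<omega> powi \<lfloor>(of_int k - C) / P\<rfloor> * F k"])
      fix v assume v: "v \<in> joint_set"
      have "\<omega> powi \<lfloor>height j v / P\<rfloor> * F (label j v) = \<omega> powi \<lfloor>(of_int (label j v) - C) / P\<rfloor> * F (label j v)"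
      proof (cases "\<lfloor>(of_int (label j v) - C) / P\<rfloor> = \<lfloor>(of_int (label j v) + C) / P\<rfloor>")
        case True
        have le: "(of_int (label j v) - C) / P \<le> height j v / P" "height j v / P \<le> (of_int (label j v) + C) / P"
          using C(2)[OF v] P by (auto intro!: divide_right_mono simp: abs_le_iff)
        then have "\<lfloor>(of_int (label j v) - C) / P\<rfloor> = \<lfloor>height j v / P\<rfloor>"
          using True floor_mono[OF le(1)] floor_mono[OF le(2)] by linarith
        then show ?thesis by simp
      qed (simp add: F_def)
      then show "modulation (phase_field \<omega> (ribbon_period j) (real M *\<^sub>R t)) u v =
          (\<omega> powi \<lfloor>(of_int (label j v) - C) / P\<rfloor> * F (label j v)) *s constant_field ?b v"
        by (simp add: modulation_def phase u_def vector_smult_assoc)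
    qed
    define B where "B = {v \<in> joint_set. F (label j v) = 0}"
    \<comment> \<open>The label is within \<open>C\<close> of a boundary and the height within
      \<open>C\<close> of the label.\<close>
    have near: "\<exists>n::int. \<bar>height j v - of_int n * P\<bar> \<le> 2 * C" if v: "v \<in> B" for v
    proof -
      let ?n = "\<lfloor>(of_int (label j v) + C) / P\<rfloor>"
      have vJ: "v \<in> joint_set" using v by (simp add: B_def)
      have "\<lfloor>(of_int (label j v) - C) / P\<rfloor> \<noteq> ?n"
        using v by (auto simp: B_def F_def split: if_splits)
      moreover have "\<lfloor>(of_int (label j v) - C) / P\<rfloor> \<le> ?n"
        using C(1) P by (intro floor_mono divide_right_mono) auto
      ultimately have "(of_int (label j v) - C) / P < of_int ?n" by linarith
      then have "of_int (label j v) - C < of_int ?n * P" using P by (simp add: pos_divide_less_eq)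
      moreover have "of_int ?n \<le> (of_int (label j v) + C) / P" by simp
      then have "of_int ?n * P \<le> of_int (label j v) + C" unfolding pos_le_divide_eq[OF P] .
      ultimately show ?thesis
        using C(2)[OF vJ] by (intro exI[of _ ?n]) linarith
    qed
    define R where "R = real M * norm t"
    have count: "L * card (B \<inter> joints_in_square c N) \<le> card (joints_in_square c (N + R))" for c N
    proof -
      let ?f = "\<lambda>(x, i). lattice (int (i * w) * m\<^sub>1 j) (int (i * w) * m\<^sub>2 j) + x"
      have lat: "lattice (int k * m\<^sub>1 j) (int k * m\<^sub>2 j) = real k *\<^sub>R t" for k
        by (simp add: t_def lattice_vector_def scaleR_add_right)
      have hl: "height j (real k *\<^sub>R t) = real k * of_int Q" for k
        using cross2_basis by (simp add: height_def cross2_scale ct)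
      have inj: "inj_on ?f ((B \<inter> joints_in_square c N) \<times> {..<L})"
      proof (rule inj_onI, clarify)
        fix x i y i'
        assume B: "x \<in> B" "y \<in> B" and i: "i < L" "i' < L"
          and eq: "lattice (int (i * w) * m\<^sub>1 j) (int (i * w) * m\<^sub>2 j) + x =
            lattice (int (i' * w) * m\<^sub>1 j) (int (i' * w) * m\<^sub>2 j) + y"
        have "real (i * w) * of_int Q + height j x = real (i' * w) * of_int Q + height j y"
          using arg_cong[OF eq, of "height j"] unfolding lat height_add hl .
        moreover obtain n n' where "\<bar>height j x - of_int n * P\<bar> \<le> 2 * C" "\<bar>height j y - of_int n' * P\<bar> \<le> 2 * C"
          using near B by metis
        ultimately have "\<bar>(real (i * w) * of_int Q - real (i' * w) * of_int Q) + (of_int n * P - of_int n' * P)\<bar> \<le> 4 * C"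
          by linarith
        \<comment> \<open>Since \<open>P\<close> is \<open>L\<close> times \<open>w * Q\<close>,
          this is an integer multiple of \<open>w * Q\<close>; being smaller than one such unit it
          is zero, so \<open>i\<close> and \<open>i'\<close> agree modulo \<open>L\<close>.\<close>
        moreover have "(real (i * w) * of_int Q - real (i' * w) * of_int Q) + (of_int n * P - of_int n' * P) =
            (real w * of_int Q) * of_int (int i - int i' + (n - n') * int L)"
          by (simp add: P_def M_def algebra_simps)
        ultimately have "(real w * of_int Q) * \<bar>of_int (int i - int i' + (n - n') * int L)\<bar> \<le> 4 * C"
          using \<open>Q > 0\<close> by (simp add: abs_mult)
        moreover have "real w * 1 \<le> real w * of_int Q"
          using \<open>Q > 0\<close> by (intro mult_left_mono) auto
        ultimately have "(real w * of_int Q) * \<bar>of_int (int i - int i' + (n - n') * int L)\<bar> < (real w * of_int Q) * 1"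
          using w by linarith
        then have "\<bar>of_int (int i - int i' + (n - n') * int L)\<bar> < (1::real)"
          using \<open>Q > 0\<close> by (simp add: w_def)
        then have z: "int i - int i' + (n - n') * int L = 0" by linarith
        then have "int i - int i' = int L * (n' - n)" by (simp add: algebra_simps)
        then have "int L dvd int i - int i'" by simp
        then have "int i = int i'"
          using i dvd_imp_le_int[of "int i - int i'" "int L"] by linarith
        then show "x = y \<and> i = i'" using eq by simp
      qed
      have "?f ` ((B \<inter> joints_in_square c N) \<times> {..<L}) \<subseteq> joints_in_square c (N + R)"
      proof clarify
        fix x i assume x: "x \<in> B" "x \<in> joints_in_square c N" and i: "i < L"
        have "real (i * w) \<le> real M"
          unfolding M_def of_nat_le_iff using i by (intro mult_right_mono) auto
        then have "norm (real (i * w) *\<^sub>R t) \<le> R"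
          unfolding R_def norm_scaleR by (intro mult_right_mono) auto
        then have tk: "\<bar>(real (i * w) *\<^sub>R t) $ k\<bar> \<le> R" for k
          using component_le_norm_cart order_trans by blast
        have xk: "\<bar>x $ k - c $ k\<bar> \<le> N" for k using x by (simp add: mem_joints_in_square)
        have "\<bar>(real (i * w) *\<^sub>R t + x) $ k - c $ k\<bar> \<le> N + R" for k
          using abs_triangle_ineq[of "(real (i * w) *\<^sub>R t) $ k" "x $ k - c $ k"] tk[of k] xk[of k]
          unfolding vector_add_component add_diff_eq by argo
        moreover have "lattice (int (i * w) * m\<^sub>1 j) (int (i * w) * m\<^sub>2 j) + x \<in> joint_set"
          using x(2) by (intro joint_lattice) (simp add: mem_joints_in_square)
        ultimately show "lattice (int (i * w) * m\<^sub>1 j) (int (i * w) * m\<^sub>2 j) + x \<in> joints_in_square c (N + R)"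
          unfolding mem_joints_in_square lat by blast
      qed
      then have "card ((B \<inter> joints_in_square c N) \<times> {..<L}) \<le> card (joints_in_square c (N + R))"
        by (rule card_inj_on_le[OF inj _ finite_joints_in_square])
      then show ?thesis by (simp add: card_cartesian_product mult.commute)
    qed
    \<comment> \<open>Mostly close demands a strict inequality, which fails on a square without
      joints.\<close>
    obtain N\<^sub>1 where N1: "\<And>N c. N \<ge> N\<^sub>1 \<Longrightarrow> joints_in_square c N \<noteq> {}"
      using joints_in_square_nonempty by blast
    have "mostly_close (joints G) \<epsilon>
                (modulation (phase_field \<omega> (ribbon_period j) (real M *\<^sub>R t)) u)
                (modulation (phase_field \<omega> (ribbon_period j) (real M *\<^sub>R t)) (constant_field ?b))" for \<omega>
      unfolding mostly_close_def joints_parallelogram_framework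
    proof (intro exI[of _ "max 1 (max N\<^sub>1 (max (4 * R) (4 * (norm a\<^sub>1 + norm a\<^sub>2))))"] allI impI)
      fix N c and S :: "(real^2) set"
      assume N: "N \<ge> max 1 (max N\<^sub>1 (max (4 * R) (4 * (norm a\<^sub>1 + norm a\<^sub>2))))"
        and S: "S = (+) c ` cbox (vec (- N)) (vec N)"
      have JS: "joint_set \<inter> S = joints_in_square c N" by (simp add: S joints_in_square_def)
      let ?A = "{p \<in> joint_set \<inter> S. norm (modulation (phase_field \<omega> (ribbon_period j) (real M *\<^sub>R t)) u p -
          modulation (phase_field \<omega> (ribbon_period j) (real M *\<^sub>R t)) (constant_field ?b) p) > \<epsilon>}"
      have "?A \<subseteq> B \<inter> joints_in_square c N"
        unfolding JS using \<epsilon>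
        by (auto simp: B_def mem_joints_in_square modulation_def u_def F_def split: if_splits)
      then have "card ?A \<le> card (B \<inter> joints_in_square c N)"
        by (intro card_mono) (simp_all add: finite_joints_in_square)
      then have "L * card ?A \<le> L * card (B \<inter> joints_in_square c N)" by simp
      also have "\<dots> \<le> card (joints_in_square c (N + R))" by (rule count)
      also have "\<dots> \<le> 4 * card (joints_in_square c N)"
        using N by (intro card_joints_in_enlarged_square) auto
      finally have "real (L * card ?A) \<le> real (4 * card (joints_in_square c N))"
        by (simp only: of_nat_le_iff)
      moreover have "card (joints_in_square c N) > 0"
        using N1[of N c] N by (simp add: card_gt_0_iff finite_joints_in_square)
      then have "4 * real (card (joints_in_square c N)) < \<epsilon> * real L * real (card (joints_in_square c N))"
        using L by (intro mult_strict_right_mono) auto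
      ultimately have "real L * real (card ?A) < real L * (\<epsilon> * real (card (joints_in_square c N)))"
        by (simp add: algebra_simps)
      then show "real (card ?A) < \<epsilon> * real (card (joint_set \<inter> S))"
        unfolding JS by (simp add: L_def)
    qed
    then show ?thesis
      using flex mflex M by blast
  qed
  ultimately show ?thesis
    unfolding periodic_slippage_line_def using basis by blast
qed

text \<open>The reciprocal of the ribbon direction
  \<open>m\<^sub>2 a\<^sub>1 - m\<^sub>1 a\<^sub>2\<close> is spanned by \<open>- m j\<close>.
  Conversely, the equation for a slippage direction says that its reciprocal vector is parallel to
  \<open>m j\<close>.\<close>

lemma slippage_spectrum_eq:
  "slippage_spectrum G a\<^sub>1 a\<^sub>2 = {x. \<exists>j<num_grids D. \<exists>c. x = c *\<^sub>R m j}"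
proof (intro set_eqI iffI)
  fix x assume "x \<in> slippage_spectrum G a\<^sub>1 a\<^sub>2"
  then obtain \<alpha> \<beta> where x: "x \<in> span {vector [\<beta>, - \<alpha>]}"
    and "periodic_slippage_line G (span {\<alpha> *\<^sub>R a\<^sub>1 + \<beta> *\<^sub>R a\<^sub>2})"
    by (auto simp: slippage_spectrum_def reciprocal_figure_def periodic_slippage_figure_def)
  then obtain j where j: "j < num_grids D" "of_int (m\<^sub>1 j) * \<alpha> + of_int (m\<^sub>2 j) * \<beta> = 0"
    using slippage_line_imp_ribbon_direction by blast
  obtain d where d: "x = d *\<^sub>R vector [\<beta>, - \<alpha>]"
    using x by (auto simp: span_singleton)
  have "cross2 (m j) (vector [\<beta>, - \<alpha>]) = 0"
    using j(2) by (simp add: cross2_def)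
  then have "cross2 (m j) x = 0" by (simp add: d cross2_scale)
  then show "x \<in> {x. \<exists>j<num_grids D. \<exists>c. x = c *\<^sub>R m j}"
    using cross2_eq_0_imp_multiple m_vec_nonzero j(1) by blast
next
  fix x assume "x \<in> {x. \<exists>j<num_grids D. \<exists>c. x = c *\<^sub>R m j}"
  then obtain j c where j: "j < num_grids D" and x: "x = c *\<^sub>R m j" by blast
  have rp: "ribbon_period j = of_int (m\<^sub>2 j) *\<^sub>R a\<^sub>1 + of_int (- m\<^sub>1 j) *\<^sub>R a\<^sub>2"
    by (simp add: ribbon_period_def lattice_vector_def)
  have "x = (- c) *\<^sub>R vector [of_int (- m\<^sub>1 j), - of_int (m\<^sub>2 j)]"
    by (simp add: x vec2_eq_iff)
  then have "x \<in> span {vector [of_int (- m\<^sub>1 j), - of_int (m\<^sub>2 j)]}"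
    by (metis insertI1 span_base span_scale)
  then show "x \<in> slippage_spectrum G a\<^sub>1 a\<^sub>2"
    using ribbon_period_slippage_line[OF j] unfolding rp slippage_spectrum_def reciprocal_figure_def
      periodic_slippage_figure_def by blast
qed

end

lemma reduce_mod1_add_integer_vector:
  assumes "z \<in> integer_vectors"
  shows "reduce_mod1 (z + x) = reduce_mod1 x"
proof -
  have "frac (z $ i + x $ i) = frac (x $ i)" for i
    using assms by (auto simp: integer_vectors_def frac_def elim!: allE[of _ i] Ints_cases)
  then show ?thesis by (simp add: reduce_mod1_def)
qed

theorem theorem4p13:
  fixes D :: multigrid and len :: "nat \<Rightarrow> real" and a\<^sub>1 a\<^sub>2 :: "real^2"
    and G :: "(real^2) framework"
  assumes "regular_multigrid D"
    and "\<forall>j<num_grids D. len j > 0"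
    and "G = parallelogram_framework D len"
    and "periodic_framework G a\<^sub>1 a\<^sub>2"
  shows "crystallographic G a\<^sub>1 a\<^sub>2 \<and>
    zero_mode_spectrum G a\<^sub>1 a\<^sub>2 =
      (\<Union>z\<in>integer_vectors. (+) z ` slippage_spectrum G a\<^sub>1 a\<^sub>2) \<and>
    zero_mode_spectrum_log G a\<^sub>1 a\<^sub>2 = slippage_spectrum_log G a\<^sub>1 a\<^sub>2"
proof -
  interpret T: periodic_parallelogram_tiling D len a\<^sub>1 a\<^sub>2
    by unfold_locales (use assms in auto)
  have K: "zero_mode_spectrum G a\<^sub>1 a\<^sub>2 = (\<Union>z\<in>integer_vectors. (+) z ` slippage_spectrum G a\<^sub>1 a\<^sub>2)"
    unfolding assms(3) T.zero_mode_spectrum_eq T.slippage_spectrum_eq by blast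
  \<comment> \<open>All translates have the same reduction; the zero translate makes the index set
    nonempty.\<close>
  have "0 \<in> integer_vectors" by (simp add: integer_vectors_def)
  moreover have "reduce_mod1 ` ((+) z ` A) = reduce_mod1 ` A" if "z \<in> integer_vectors" for z A
    using reduce_mod1_add_integer_vector[OF that] by (simp add: image_image)
  ultimately have "zero_mode_spectrum_log G a\<^sub>1 a\<^sub>2 = slippage_spectrum_log G a\<^sub>1 a\<^sub>2"
    unfolding zero_mode_spectrum_log_def slippage_spectrum_log_def K image_UN by auto
  then show ?thesis
    using K T.crystallographic_G assms(3) by blast
qed

end
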